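(* If $\mu_1,\mu_2$ are probability measures on $\mathbb R_+=[0,\infty)$ and $\mu_2$ is not concentrated at zero ($\mu_2\ne\delta_0$), then there exists a unique probability measure $\mu$ on $\mathbb R_+$ such that $$\eta_\mu(z)=\frac{z\,\eta_{\mu_1}(\eta_{\mu_2}(z))}{\eta_{\mu_2}(z)}$$ for all $z\in\mathbb C\setminus\mathbb R_+$.
   Context: For a probability measure $\mu$ on $\mathbb R_+$, $\psi_\mu(z)=\int_{\mathbb R_+}\frac{zt}{1-zt}\,d\mu(t)$ and $\eta_\mu(z)=\frac{\psi_\mu(z)}{1+\psi_\mu(z)}$ for $z\in\mathbb C\setminus\mathbb R_+$. (The measure $\mu$ is called the orthogonal multiplicative convolution $\mu_1\angle\mu_2$.) *)

theory Defs
  imports "HOL-Probability.Probability" "HOL-Complex_Analysis.Complex_Analysis"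
begin

abbreviation borel_Rplus :: "real measure" where
  "borel_Rplus \<equiv> restrict_space borel {0..}"

definition prob_measure_Rplus :: "real measure \<Rightarrow> bool" where
  "prob_measure_Rplus \<mu> \<longleftrightarrow> prob_space \<mu> \<and> sets \<mu> = sets borel_Rplus"

text \<open>
  The functions below are meant for \<open>z\<close> outside \<open>\<real>\<^sub>\<ge>\<^sub>0\<close>.  There the integrand is bounded on the
  support, so the Bochner integral is the usual one, and
  \<open>1 + psi \<mu> z = \<integral> 1 / (1 - z t) d\<mu>(t)\<close> does not vanish, so the division in \<open>eta\<close> is proper.
\<close>

definition psi :: "real measure \<Rightarrow> complex \<Rightarrow> complex" where
  "psi \<mu> z = (\<integral>t. z * complex_of_real t / (1 - z * complex_of_real t) \<partial>\<mu>)"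

definition eta :: "real measure \<Rightarrow> complex \<Rightarrow> complex" where
  "eta \<mu> z = psi \<mu> z / (1 + psi \<mu> z)"

end

theory Submission
  imports Defs "HOL-Computational_Algebra.Fundamental_Theorem_Algebra"
begin

text \<open>
  Write \<open>A\<^sub>\<mu> z = 1 + \<psi>\<^sub>\<mu> z = \<integral> 1 / (1 - z t) d\<mu>(t)\<close>, so that \<open>\<eta>\<^sub>\<mu> = 1 - 1 / A\<^sub>\<mu>\<close>; the task is to represent
  \<open>\<Phi> = 1 / (1 - \<eta>)\<close>, with \<open>\<eta>\<close> the prescribed right-hand side, as such an integral. For \<open>Im z > 0\<close> the
  variance inequality gives \<open>arg z \<le> arg (\<eta>\<^sub>\<mu> z) < \<pi>\<close>, and this property passes to the composition, so
  both \<open>\<Phi>\<close> and \<open>z \<Phi>(z)\<close> map the upper half-plane into its closure. If both measures have finite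
  support, \<open>\<Phi>\<close> is rational; the first condition makes its poles simple with residues of the right
  sign, the second makes its polynomial part a nonnegative constant, and partial fractions exhibit
  the measure. The general case follows by discretising both measures and extracting a weak limit
  in the compact coordinate \<open>s = 1 / (1 + t)\<close>; no mass is lost at \<open>t = \<infinity>\<close> because \<open>\<Phi>(-x) \<rightarrow> 1\<close> as
  \<open>x \<rightarrow> 0\<close>. For uniqueness, with \<open>r = t / (1 + t)\<close> the expansion of
  \<open>A\<^sub>\<mu> (y - 1) = \<integral> (1 - r) / (1 - y r) d\<mu>\<close> in powers of \<open>y\<close> determines the moments of \<open>r\<close>.
\<close>

section \<open>Resolvent means of measures on the half-line\<close>

definition resolvent_mean :: "real measure \<Rightarrow> complex \<Rightarrow> complex" where
  "resolvent_mean \<mu> z = (\<integral>t. 1 / (1 - z * complex_of_real t) \<partial>\<mu>)"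

section \<open>Geometry of the plane slit along the nonnegative reals\<close>

lemma slit_iff: "(z::complex) \<notin> \<real>\<^sub>\<ge>\<^sub>0 \<longleftrightarrow> Im z \<noteq> 0 \<or> Re z < 0"
  by (auto simp: complex_nonneg_Reals_iff)

text \<open>The upper half-plane carries the estimates, the lower one follows by conjugation, and
  the negative axis is treated with real integrals.\<close>

lemma slit_cases:
  assumes "z \<notin> \<real>\<^sub>\<ge>\<^sub>0"
  obtains "Im z > 0" | "Im (cnj z) > 0" | x where "z = - complex_of_real x" "x > 0"
proof -
  consider "Im z > 0" | "Im z < 0" | "Im z = 0" "Re z < 0"
    using assms by (force simp: slit_iff)
  then show ?thesis
  proof cases
    case 3
    have "z = - complex_of_real (- Re z)"
      using 3 by (simp add: complex_eq_iff)
    with 3 that(3)[of "- Re z"] show ?thesis by simp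
  qed (use that in auto)
qed

lemma slit_nonzero: "(z::complex) \<notin> \<real>\<^sub>\<ge>\<^sub>0 \<Longrightarrow> z \<noteq> 0"
  by (auto simp: slit_iff)

lemma infdist_slit_pos: "(z::complex) \<notin> \<real>\<^sub>\<ge>\<^sub>0 \<Longrightarrow> infdist z \<real>\<^sub>\<ge>\<^sub>0 > 0"
  using in_closed_iff_infdist_zero[OF closed_nonneg_Reals_complex, of z] infdist_nonneg[of z "\<real>\<^sub>\<ge>\<^sub>0"]
  by (metis empty_iff less_eq_real_def nonneg_Reals_zero_I)

text \<open>A bound for the integrand \<open>1 / (1 - z t)\<close> uniform in
  \<open>t \<ge> 0\<close>. Its continuity in \<open>z\<close> provides domination when the argument
  itself converges.\<close>

definition slit_bound :: "complex \<Rightarrow> real" where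
  "slit_bound z = (infdist z \<real>\<^sub>\<ge>\<^sub>0 + cmod z) / infdist z \<real>\<^sub>\<ge>\<^sub>0"

lemma resolvent_nonzero:
  assumes "z \<notin> \<real>\<^sub>\<ge>\<^sub>0" "t \<ge> 0"
  shows "1 - z * complex_of_real t \<noteq> 0"
proof
  assume h: "1 - z * complex_of_real t = 0"
  then have "t \<noteq> 0" by auto
  then have "z = complex_of_real (1 / t)"
    using h by (simp add: field_simps)
  then show False using assms by simp
qed

text \<open>With d the distance from z to the half-line, split at t = 1 / (d + |z|). For larger t, 1
  - z t = -t (z - 1/t) with 1/t on the half-line, so its modulus is at least t d. For smaller t it
  is at least 1 - t |z|. Both are at least d / (d + |z|).\<close>

lemma norm_resolvent_le:
  assumes "z \<notin> \<real>\<^sub>\<ge>\<^sub>0" "t \<ge> 0"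
  shows "cmod (1 / (1 - z * complex_of_real t)) \<le> slit_bound z"
proof -
  define d where "d = infdist z \<real>\<^sub>\<ge>\<^sub>0"
  have d: "d > 0" unfolding d_def by (rule infdist_slit_pos) fact
  have "d / (d + cmod z) \<le> cmod (1 - z * complex_of_real t)"
  proof (cases "t * (d + cmod z) \<ge> 1")
    case True
    then have t: "t > 0" using assms(2) by (cases "t = 0") auto
    have "d / (d + cmod z) \<le> t * d"
      using True d by (simp add: field_simps add_pos_nonneg)
         (metis d less_eq_real_def mult.commute mult_cancel_left1 mult_le_cancel_left1 not_less distrib_left)
    also have "d \<le> dist z (complex_of_real (1 / t))"
      unfolding d_def using t by (intro infdist_le) (simp del: of_real_divide)
    then have "t * d \<le> t * cmod (z - complex_of_real (1 / t))"
      using t by (simp add: dist_norm)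
    also have "\<dots> = cmod (complex_of_real t * (z - complex_of_real (1 / t)))"
      using t by (simp add: norm_mult)
    also have "complex_of_real t * (z - complex_of_real (1 / t)) = - (1 - z * complex_of_real t)"
      using t by (simp add: field_simps)
    finally show ?thesis by (simp only: norm_minus_cancel)
  next
    case False
    have "d + cmod z \<noteq> 0" using d norm_ge_zero[of z] by linarith
    then have "d / (d + cmod z) = 1 - cmod z * (1 / (d + cmod z))"
      by (simp add: divide_simps)
    also have "\<dots> \<le> 1 - cmod z * t"
      using False d by (intro diff_mono mult_left_mono) (auto simp: field_simps add_pos_nonneg)
    also have "\<dots> \<le> cmod (1 - z * complex_of_real t)"
      using norm_triangle_ineq2[of 1 "z * complex_of_real t"] assms by (simp add: norm_mult)
    finally show ?thesis .
  qed
  moreover have "d / (d + cmod z) > 0" using d by (simp add: add_pos_nonneg)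
  ultimately have "1 / cmod (1 - z * complex_of_real t) \<le> 1 / (d / (d + cmod z))"
    by (intro divide_left_mono mult_pos_pos) linarith+
  then show ?thesis by (simp add: slit_bound_def d_def norm_divide)
qed

lemma slit_bound_tendsto:
  assumes "z \<notin> \<real>\<^sub>\<ge>\<^sub>0" "(Z \<longlongrightarrow> z) F"
  shows "((\<lambda>n. slit_bound (Z n)) \<longlongrightarrow> slit_bound z) F"
  unfolding slit_bound_def using infdist_slit_pos[OF assms(1)]
  by (intro tendsto_intros tendsto_infdist assms) auto

lemma eventually_slit:
  fixes z :: complex
  assumes "z \<notin> \<real>\<^sub>\<ge>\<^sub>0" "(Z \<longlongrightarrow> z) F"
  shows "\<forall>\<^sub>F n in F. Z n \<notin> \<real>\<^sub>\<ge>\<^sub>0"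
  using topological_tendstoD[OF assms(2), of "- \<real>\<^sub>\<ge>\<^sub>0"] closed_nonneg_Reals_complex assms(1)
  by (simp add: open_Compl)

lemma borel_measurable_resolvent [measurable]:
  "(\<lambda>t. 1 / (1 - z * complex_of_real t)) \<in> borel_measurable borel"
  by measurable

locale Rplus_prob = prob_space \<mu> for \<mu> :: "real measure" +
  assumes sets_Rplus: "sets \<mu> = sets borel_Rplus"
begin

lemma space_Rplus: "space \<mu> = {0..}"
  using sets_eq_imp_space_eq[OF sets_Rplus] by (simp add: space_restrict_space)

lemma measurable_Rplus: "f \<in> borel_measurable borel \<Longrightarrow> f \<in> measurable \<mu> borel"
  by (subst measurable_cong_sets[OF sets_Rplus refl]) (rule measurable_restrict_space1)

lemma AE_nonneg: "AE t in \<mu>. t \<ge> 0"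
  by (rule AE_I2) (simp add: space_Rplus)

lemma resolvent_measurable [measurable]:
  "(\<lambda>t. 1 / (1 - z * complex_of_real t)) \<in> borel_measurable \<mu>"
  by (rule measurable_Rplus) measurable

lemma id_measurable [measurable]: "(\<lambda>t. t) \<in> borel_measurable \<mu>"
  by (rule measurable_Rplus) measurable

lemma resolvent_integrable:
  assumes "z \<notin> \<real>\<^sub>\<ge>\<^sub>0"
  shows "integrable \<mu> (\<lambda>t. 1 / (1 - z * complex_of_real t))"
  by (rule integrable_const_bound[of _ "slit_bound z"])
     (use AE_nonneg norm_resolvent_le[OF assms] in \<open>auto elim!: eventually_mono\<close>)

lemma psi_eq:
  assumes "z \<notin> \<real>\<^sub>\<ge>\<^sub>0"
  shows "psi \<mu> z = resolvent_mean \<mu> z - 1"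
proof -
  have "psi \<mu> z = (\<integral>t. 1 / (1 - z * complex_of_real t) - 1 \<partial>\<mu>)"
    unfolding psi_def
    by (intro Bochner_Integration.integral_cong refl)
       (use resolvent_nonzero[OF assms] in \<open>auto simp: space_Rplus field_simps\<close>)
  also have "\<dots> = resolvent_mean \<mu> z - 1"
    using resolvent_integrable[OF assms] by (simp add: resolvent_mean_def prob_space)
  finally show ?thesis .
qed

lemma resolvent_mean_cnj: "resolvent_mean \<mu> (cnj z) = cnj (resolvent_mean \<mu> z)"
  unfolding resolvent_mean_def by (simp flip: Bochner_Integration.integral_cnj)

lemma eta_cnj: 
  "eta \<mu> (cnj z) = cnj (eta \<mu> z)"
proof -
  have "psi \<mu> (cnj z) = cnj (psi \<mu> z)"
    unfolding psi_def by (simp flip: Bochner_Integration.integral_cnj)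
  then show ?thesis by (simp add: eta_def)
qed

end

section \<open>Signs of imaginary parts in the upper half-plane\<close>

lemma Im_resolvent: "Im (1 / (1 - z * complex_of_real t)) = t * Im z / (cmod (1 - z * complex_of_real t))\<^sup>2"
  by (simp add: Im_divide cmod_power2)

lemma Im_mult_resolvent: "Im (z / (1 - z * complex_of_real t)) = Im z / (cmod (1 - z * complex_of_real t))\<^sup>2"
  by (simp add: Im_divide cmod_power2 algebra_simps)

context Rplus_prob
begin

text \<open>The second absolute moment of the resolvent. It is the factor in
  \<open>Im (z * resolvent_mean \<mu> z)\<close>, so comparing it with the squared modulus of the
  mean yields arg z \<le> arg (\<open>eta \<mu> z\<close>).\<close>

abbreviation sqmean :: "complex \<Rightarrow> real" where
  "sqmean z \<equiv> \<integral>t. (cmod (1 / (1 - z * complex_of_real t)))\<^sup>2 \<partial>\<mu>"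

lemma sq_resolvent_integrable:
  assumes "z \<notin> \<real>\<^sub>\<ge>\<^sub>0"
  shows "integrable \<mu> (\<lambda>t. (cmod (1 / (1 - z * complex_of_real t)))\<^sup>2)"
proof (rule integrable_const_bound[of _ "(slit_bound z)\<^sup>2"])
  show "AE t in \<mu>. norm ((cmod (1 / (1 - z * complex_of_real t)))\<^sup>2) \<le> (slit_bound z)\<^sup>2"
    using AE_nonneg
  proof (eventually_elim)
    case (elim t)
    show ?case using power_mono[OF norm_resolvent_le[OF assms elim] norm_ge_zero, of 2]
      by (simp add: power_divide norm_power)
  qed
qed measurable

lemma sqmean_pos:
  assumes "z \<notin> \<real>\<^sub>\<ge>\<^sub>0"
  shows "sqmean z > 0"
proof -
  have "sqmean z \<noteq> 0"
  proof
    assume "sqmean z = 0"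
    then have "AE t in \<mu>. (cmod (1 / (1 - z * complex_of_real t)))\<^sup>2 = 0"
      using sq_resolvent_integrable[OF assms]
      by (subst (asm) integral_nonneg_eq_0_iff_AE) auto
    with AE_nonneg have "AE t in \<mu>. False"
      by eventually_elim (use resolvent_nonzero[OF assms] in auto)
    then show False by simp
  qed
  moreover have "sqmean z \<ge> 0" by (intro integral_nonneg_AE) auto
  ultimately show ?thesis by linarith
qed

text \<open>The modulus of the mean is at most the mean modulus, and the square of the latter is at
  most the mean square because a variance is nonnegative.\<close>

lemma norm_resolvent_mean_sq_le:
  assumes "z \<notin> \<real>\<^sub>\<ge>\<^sub>0"
  shows "(cmod (resolvent_mean \<mu> z))\<^sup>2 \<le> sqmean z"
proof -
  let ?X = "\<lambda>t. cmod (1 / (1 - z * complex_of_real t))"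
  have i: "integrable \<mu> ?X" 
    by (rule integrable_norm[OF resolvent_integrable[OF assms]])
  have "cmod (resolvent_mean \<mu> z) \<le> expectation ?X"
    unfolding resolvent_mean_def by (rule integral_norm_bound)
  then have "(cmod (resolvent_mean \<mu> z))\<^sup>2 \<le> (expectation ?X)\<^sup>2"
    by (intro power_mono) auto
  also have "\<dots> \<le> sqmean z"
    using variance_positive[of ?X] variance_eq[OF i sq_resolvent_integrable[OF assms]]
    by simp
  finally show ?thesis .
qed

lemma Im_mult_resolvent_mean:
  assumes "z \<notin> \<real>\<^sub>\<ge>\<^sub>0"
  shows "Im (z * resolvent_mean \<mu> z) = Im z * sqmean z"
proof -
  have "z * resolvent_mean \<mu> z = (\<integral>t. z * (1 / (1 - z * complex_of_real t)) \<partial>\<mu>)"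
    unfolding resolvent_mean_def by (rule integral_mult_right_zero[symmetric])
  then have "Im (z * resolvent_mean \<mu> z) = (\<integral>t. Im (z * (1 / (1 - z * complex_of_real t))) \<partial>\<mu>)"
    using integral_Im[OF integrable_mult_right[OF resolvent_integrable[OF assms], of z]] by simp
  also have "\<dots> = (\<integral>t. Im z * (cmod (1 / (1 - z * complex_of_real t)))\<^sup>2 \<partial>\<mu>)"
    by (simp add: Im_mult_resolvent norm_divide power_divide)
  finally show ?thesis by simp
qed

lemma Im_resolvent_mean_nonneg:
  assumes "Im z > 0"
  shows "Im (resolvent_mean \<mu> z) \<ge> 0"
proof -
  have z: "z \<notin> \<real>\<^sub>\<ge>\<^sub>0" using assms by (auto simp: slit_iff)
  have "Im (resolvent_mean \<mu> z) = (\<integral>t. Im (1 / (1 - z * complex_of_real t)) \<partial>\<mu>)"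
    unfolding resolvent_mean_def using resolvent_integrable[OF z] by simp
  also have "\<dots> \<ge> 0"
    using AE_nonneg assms
    by (intro integral_nonneg_AE) (auto elim!: eventually_mono simp: Im_resolvent)
  finally show ?thesis .
qed

lemma Im_resolvent_mean_pos:
  assumes "Im z > 0" "\<not> (AE t in \<mu>. t = 0)"
  shows "Im (resolvent_mean \<mu> z) > 0"
proof -
  have z: "z \<notin> \<real>\<^sub>\<ge>\<^sub>0" using assms by (auto simp: slit_iff)
  have e: "Im (resolvent_mean \<mu> z) = (\<integral>t. Im (1 / (1 - z * complex_of_real t)) \<partial>\<mu>)"
    unfolding resolvent_mean_def using resolvent_integrable[OF z] by simp
  have "Im (resolvent_mean \<mu> z) \<noteq> 0"
  proof
    assume "Im (resolvent_mean \<mu> z) = 0"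
    then have "AE t in \<mu>. Im (1 / (1 - z * complex_of_real t)) = 0"
      unfolding e using AE_nonneg assms integrable_Im[OF resolvent_integrable[OF z]]
      by (subst (asm) integral_nonneg_eq_0_iff_AE) (auto elim!: eventually_mono simp add: Im_resolvent simp del: Im_divide_Reals)
    with AE_nonneg have "AE t in \<mu>. t = 0"
      by eventually_elim (use assms(1) resolvent_nonzero[OF z] in \<open>auto simp: Im_resolvent\<close>)
    with assms show False by simp
  qed
  with Im_resolvent_mean_nonneg[OF assms(1)] show ?thesis by linarith
qed

text \<open>Despite the name this is a Stieltjes-type transform: the value of
  \<open>resolvent_mean \<mu>\<close> at -x, kept as a real integral.\<close>

abbreviation laplace_mean :: "real \<Rightarrow> real" where
  "laplace_mean x \<equiv> \<integral>t. 1 / (1 + x * t) \<partial>\<mu>"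

lemma laplace_integrable:
  assumes "x \<ge> 0"
  shows "integrable \<mu> (\<lambda>t. 1 / (1 + x * t))"
proof (rule integrable_const_bound[of _ 1])
  show "AE t in \<mu>. norm (1 / (1 + x * t)) \<le> 1"
    using AE_nonneg by eventually_elim (use assms in \<open>simp add: add_pos_nonneg\<close>)
qed simp

lemma resolvent_mean_neg:
  "resolvent_mean \<mu> (- complex_of_real x) = complex_of_real (laplace_mean x)"
proof -
  have "resolvent_mean \<mu> (- complex_of_real x) = (\<integral>t. complex_of_real (1 / (1 + x * t)) \<partial>\<mu>)"
    unfolding resolvent_mean_def by simp
  then show ?thesis by (simp del: of_real_divide)
qed

text \<open>Pointwise, 1 - 1/(1 + x t) = x t / (1 + x t) \<ge> x t / (1 + t). This linear lower
  bound later keeps x divided by |\<open>eta M2 (- x)\<close>| bounded as x tends to 0.\<close>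

lemma one_minus_laplace_mean:
  assumes "x > 0" "x \<le> 1"
  shows "1 - laplace_mean x \<ge> x * (1 - laplace_mean 1)"
proof -
  have "x * (1 - laplace_mean 1) = (\<integral>t. x * (1 - 1 / (1 + 1 * t)) \<partial>\<mu>)"
    using laplace_integrable[of 1] by (simp add: prob_space)
  also have "\<dots> \<le> (\<integral>t. 1 - 1 / (1 + x * t) \<partial>\<mu>)"
  proof (rule integral_mono_AE)
    show "AE t in \<mu>. x * (1 - 1 / (1 + 1 * t)) \<le> 1 - 1 / (1 + x * t)"
      using AE_nonneg
    proof eventually_elim
      case (elim t)
      have "x * (1 - 1 / (1 + 1 * t)) = x * t / (1 + t)"
        using elim by (simp add: field_simps)
      also have "\<dots> \<le> x * t / (1 + x * t)"
        using elim assms mult_right_mono[of x 1 t] by (intro divide_left_mono) (auto simp: add_pos_nonneg)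
      also have "\<dots> = 1 - 1 / (1 + x * t)"
        using elim assms by (simp add: field_simps add_nonneg_eq_0_iff)
      finally show ?case .
    qed
  qed (use laplace_integrable[of 1] laplace_integrable[of x] assms in auto)
  also have "\<dots> = 1 - laplace_mean x"
    using laplace_integrable[of x] assms by (simp add: prob_space)
  finally show ?thesis .
qed

lemma laplace_mean_le_1:
  assumes "x \<ge> 0"
  shows "laplace_mean x \<le> 1"
proof -
  have "laplace_mean x \<le> (\<integral>t. 1 \<partial>\<mu>)"
    using AE_nonneg assms laplace_integrable[OF assms]
    by (intro integral_mono_AE) (auto elim!: eventually_mono simp: field_simps add_pos_nonneg)
  then show ?thesis by (simp add: prob_space)
qed

lemma laplace_mean_pos:
  assumes "x \<ge> 0"
  shows "laplace_mean x > 0"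
proof -
  have "laplace_mean x \<noteq> 0"
  proof
    assume "laplace_mean x = 0"
    then have "AE t in \<mu>. 1 / (1 + x * t) = 0"
      using laplace_integrable[OF assms] AE_nonneg assms
      by (subst (asm) integral_nonneg_eq_0_iff_AE) (auto elim!: eventually_mono)
    with AE_nonneg have "AE t in \<mu>. False"
      by eventually_elim (use assms in \<open>auto simp: add_nonneg_eq_0_iff\<close>)
    then show False by simp
  qed
  moreover have "laplace_mean x \<ge> 0"
    using AE_nonneg assms by (intro integral_nonneg_AE) (auto elim!: eventually_mono)
  ultimately show ?thesis by linarith
qed

lemma laplace_mean_less_1:
  assumes "x > 0" "\<not> (AE t in \<mu>. t = 0)"
  shows "laplace_mean x < 1"
proof -
  have "laplace_mean x \<noteq> 1"
  proof
    assume "laplace_mean x = 1"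
    then have "(\<integral>t. 1 - 1 / (1 + x * t) \<partial>\<mu>) = 0"
      using laplace_integrable[of x] assms by (simp add: prob_space)
    then have "AE t in \<mu>. 1 - 1 / (1 + x * t) = 0"
      using laplace_integrable[of x] AE_nonneg assms
      by (subst (asm) integral_nonneg_eq_0_iff_AE)
         (auto elim!: eventually_mono simp: field_simps add_pos_nonneg)
    with AE_nonneg have "AE t in \<mu>. t = 0"
      by eventually_elim (use assms in \<open>auto simp: field_simps add_nonneg_eq_0_iff split: if_splits\<close>)
    with assms show False by simp
  qed
  with laplace_mean_le_1[of x] assms show ?thesis by linarith
qed

text \<open>Off the real axis \<open>Im (z * resolvent_mean \<mu> z)\<close> is \<open>Im z\<close>
  times a positive mean square; on the negative axis the value is a positive mean.\<close>

lemma resolvent_mean_nonzero: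
  assumes "z \<notin> \<real>\<^sub>\<ge>\<^sub>0"
  shows "resolvent_mean \<mu> z \<noteq> 0"
proof -
  have *: "resolvent_mean \<mu> w \<noteq> 0" if "Im w > 0" for w
  proof -
    have w: "w \<notin> \<real>\<^sub>\<ge>\<^sub>0" using that by (auto simp: slit_iff)
    then show ?thesis
      using Im_mult_resolvent_mean[OF w] sqmean_pos[OF w] that by auto
  qed
  from assms show ?thesis
  proof (cases z rule: slit_cases)
    case (3 x)
    then show ?thesis using laplace_mean_pos[of x] by (simp add: resolvent_mean_neg)
  qed (use *[of z] *[of "cnj z"] resolvent_mean_cnj[of z] in auto)
qed

section \<open>Mapping properties of \<open>eta\<close>\<close>

lemma eta_eq:
  assumes "z \<notin> \<real>\<^sub>\<ge>\<^sub>0"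
  shows "eta \<mu> z = 1 - 1 / resolvent_mean \<mu> z"
  using resolvent_mean_nonzero[OF assms] by (simp add: eta_def psi_eq[OF assms] field_simps)

lemma Im_eta_nonneg:
  assumes "Im z > 0"
  shows "Im (eta \<mu> z) \<ge> 0"
proof -
  have z: "z \<notin> \<real>\<^sub>\<ge>\<^sub>0" using assms by (auto simp: slit_iff)
  show ?thesis using Im_resolvent_mean_nonneg[OF assms]
    by (simp add: eta_eq[OF z] Im_divide)
qed

lemma Im_eta_pos:
  assumes "Im z > 0" "\<not> (AE t in \<mu>. t = 0)"
  shows "Im (eta \<mu> z) > 0"
proof -
  have z: "z \<notin> \<real>\<^sub>\<ge>\<^sub>0" using assms by (auto simp: slit_iff)
  show ?thesis using Im_resolvent_mean_pos[OF assms] resolvent_mean_nonzero[OF z]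
    by (simp add: eta_eq[OF z] Im_divide complex_neq_0 divide_pos_pos)
qed

text \<open>Writing A for the resolvent mean, eta / z = 1/z - 1/(z A) has imaginary part (Im z /
  |z|^2) (sqmean / |A|^2 - 1), nonnegative by the variance inequality. Together with Im eta \<ge> 0
  this says that arg z \<le> arg eta unless eta vanishes.\<close>

lemma Im_eta_over_nonneg:
  assumes "Im z > 0"
  shows "Im (eta \<mu> z / z) \<ge> 0"
proof -
  have z: "z \<notin> \<real>\<^sub>\<ge>\<^sub>0" using assms by (auto simp: slit_iff)
  define A where "A = resolvent_mean \<mu> z"
  have nz: "A \<noteq> 0" "z \<noteq> 0" using resolvent_mean_nonzero[OF z] z by (auto simp: A_def)
  have im: "Im (1 / w) = - Im w / (cmod w)\<^sup>2" for w by (simp add: Im_divide cmod_power2)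
  have "eta \<mu> z / z = 1 / z - 1 / (z * A)"
    unfolding eta_eq[OF z] A_def[symmetric] using nz by (simp add: field_simps)
  then have "Im (eta \<mu> z / z) = Im z * sqmean z / (cmod (z * A))\<^sup>2 - Im z / (cmod z)\<^sup>2"
    using Im_mult_resolvent_mean[OF z] by (simp only: minus_complex.sel im A_def)
  also have "\<dots> = Im z / (cmod z)\<^sup>2 * (sqmean z / (cmod A)\<^sup>2 - 1)"
    using nz by (simp add: norm_mult field_simps)
  also have "\<dots> \<ge> 0"
    using norm_resolvent_mean_sq_le[OF z] nz assms by (auto simp: A_def[symmetric] field_simps)
  finally show ?thesis .
qed

lemma eta_neg:
  assumes "x > 0"
  shows "eta \<mu> (- complex_of_real x) = - complex_of_real (1 / laplace_mean x - 1)"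
proof -
  have z: "- complex_of_real x \<notin> \<real>\<^sub>\<ge>\<^sub>0" using assms by (simp add: slit_iff)
  show ?thesis by (simp add: eta_eq[OF z] resolvent_mean_neg)
qed

text \<open>Makes the composition of two etas meaningful. For the point mass at 0 the function
  \<open>eta\<close> is identically 0, which is why that measure is excluded as the inner
  one.\<close>

lemma eta_slit:
  assumes "\<not> (AE t in \<mu>. t = 0)" "z \<notin> \<real>\<^sub>\<ge>\<^sub>0"
  shows "eta \<mu> z \<notin> \<real>\<^sub>\<ge>\<^sub>0"
  using assms(2)
proof (cases z rule: slit_cases)
  case (3 x)
  have "1 / laplace_mean x - 1 > 0"
    using laplace_mean_pos[of x] laplace_mean_less_1[of x] 3 assms by (simp add: field_simps)
  then show ?thesis using eta_neg[OF 3(2)] 3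
    by (simp add: slit_iff del: of_real_diff)
qed (use Im_eta_pos[of z] Im_eta_pos[of "cnj z"] eta_cnj[of z] assms in \<open>auto simp: slit_iff\<close>)

lemma one_minus_eta:
  assumes "z \<notin> \<real>\<^sub>\<ge>\<^sub>0"
  shows "1 - eta \<mu> z \<noteq> 0" "1 / (1 - eta \<mu> z) = resolvent_mean \<mu> z"
  using resolvent_mean_nonzero[OF assms] by (auto simp: eta_eq[OF assms])

text \<open>The argument and the integration variable are perturbed at once, because a discretised
  outer measure will be evaluated at the \<open>eta\<close> of a discretised inner one.\<close>

lemma resolvent_mean_tendsto:
  assumes "z \<notin> \<real>\<^sub>\<ge>\<^sub>0" "Z \<longlonglongrightarrow> z"
    and "\<And>n. \<tau> n \<in> borel_measurable borel" "\<And>n t. t \<ge> 0 \<Longrightarrow> \<tau> n t \<ge> 0"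
    and "\<And>t. t \<ge> 0 \<Longrightarrow> (\<lambda>n. \<tau> n t) \<longlonglongrightarrow> t"
  shows "(\<lambda>n. \<integral>t. 1 / (1 - Z n * complex_of_real (\<tau> n t)) \<partial>\<mu>) \<longlonglongrightarrow> resolvent_mean \<mu> z"
proof -
  \<comment> \<open>Continuity of \<open>slit_bound\<close> gives one dominating constant for all
    large n; the initial terms, where \<open>Z n\<close> may lie on the half-line, are shifted
    away.\<close>
  have "\<forall>\<^sub>F n in sequentially. Z n \<notin> \<real>\<^sub>\<ge>\<^sub>0 \<and> slit_bound (Z n) < slit_bound z + 1"
    using eventually_slit[OF assms(1,2)] order_tendstoD(2)[OF slit_bound_tendsto[OF assms(1,2)], of "slit_bound z + 1"]
    by (simp add: eventually_conj)
  then obtain N where N: "\<And>n. n \<ge> N \<Longrightarrow> Z n \<notin> \<real>\<^sub>\<ge>\<^sub>0 \<and> slit_bound (Z n) < slit_bound z + 1"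
    by (auto simp: eventually_sequentially)
  have [measurable]: "\<tau> n \<in> borel_measurable \<mu>" for n
    by (rule measurable_Rplus) (rule assms)
  have "(\<lambda>n. \<integral>t. 1 / (1 - Z (n + N) * complex_of_real (\<tau> (n + N) t)) \<partial>\<mu>) \<longlonglongrightarrow> resolvent_mean \<mu> z"
    unfolding resolvent_mean_def
  proof (rule integral_dominated_convergence[where w = "\<lambda>_. slit_bound z + 1"])
    show "AE t in \<mu>. (\<lambda>n. 1 / (1 - Z (n + N) * complex_of_real (\<tau> (n + N) t))) \<longlonglongrightarrow> 1 / (1 - z * complex_of_real t)"
      using AE_nonneg
    proof eventually_elim
      case (elim t)
      then show ?case
        by (intro tendsto_intros LIMSEQ_ignore_initial_segment assms(2) assms(5)[OF elim] resolvent_nonzero[OF assms(1)])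
    qed
    show "AE t in \<mu>. norm (1 / (1 - Z (n + N) * complex_of_real (\<tau> (n + N) t))) \<le> slit_bound z + 1" for n
      using AE_nonneg
    proof eventually_elim
      case (elim t)
      then show ?case
        using norm_resolvent_le[of "Z (n + N)" "\<tau> (n + N) t"] N[of "n + N"] assms(4)[OF elim] by force
    qed
  qed simp_all
  then show ?thesis by (rule LIMSEQ_offset)
qed

lemma laplace_mean_tendsto:
  assumes "\<And>n. y n > 0" "y \<longlonglongrightarrow> 0"
  shows "(\<lambda>n. laplace_mean (y n)) \<longlonglongrightarrow> 1"
proof -
  have "(\<lambda>n. laplace_mean (y n)) \<longlonglongrightarrow> (\<integral>t. 1 \<partial>\<mu>)"
  proof (rule integral_dominated_convergence[where w = "\<lambda>_. 1"])
    show "AE t in \<mu>. (\<lambda>n. 1 / (1 + y n * t)) \<longlonglongrightarrow> 1"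
    proof (rule AE_I2)
      fix t :: real
      have "(\<lambda>n. 1 / (1 + y n * t)) \<longlonglongrightarrow> 1 / (1 + 0 * t)"
        by (intro tendsto_intros assms) auto
      then show "(\<lambda>n. 1 / (1 + y n * t)) \<longlonglongrightarrow> 1" by simp
    qed
    show "AE t in \<mu>. norm (1 / (1 + y n * t)) \<le> 1" for n
      using AE_nonneg by eventually_elim (use assms(1)[of n] in \<open>simp add: field_simps add_pos_nonneg\<close>)
  qed simp_all
  then show ?thesis by (simp add: prob_space)
qed

end

section \<open>Rational functions on the slit plane\<close>

text \<open>The rotated values of g sweep an open arc of length m pi inside the closed upper
  half-plane. For m \<ge> 2 the arc contains opposite points, first along one direction and then
  along a second, which kills g. For m = 1 the arc fits only if g lies on the nonnegative
  axis.\<close>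

lemma halfplane_cone:
  assumes "m \<ge> 1" and im: "\<And>\<phi>. 0 < \<phi> \<Longrightarrow> \<phi> < real m * pi \<Longrightarrow> Im (g * cis \<phi>) \<ge> 0"
  shows "m \<ge> 2 \<Longrightarrow> g = 0" "m = 1 \<Longrightarrow> Im g = 0 \<and> Re g \<ge> 0"
proof -
  assume "m \<ge> 2"
  then have m: "real m * pi \<ge> 2 * pi" by (intro mult_right_mono) auto
  have c: "cis (x + pi) = - cis x" for x by (simp add: complex_eq_iff)
  have "Im (g * cis (pi / 2)) \<ge> 0" "Im (g * cis (pi / 2 + pi)) \<ge> 0"
    using m pi_gt_zero by (intro im; linarith)+
  then have "Re g = 0" by (simp only: c) simp
  have "Im (g * cis (pi / 4)) \<ge> 0" "Im (g * cis (pi / 4 + pi)) \<ge> 0"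
    using m pi_gt_zero by (intro im; linarith)+
  then have "Im g = 0" using \<open>Re g = 0\<close> by (simp only: c) (simp add: cos_45)
  with \<open>Re g = 0\<close> show "g = 0" by (simp add: complex_eq_iff)
next
  assume m: "m = 1"
  have e: "Im (g * cis \<phi>) = cmod g * sin (Arg g + \<phi>)" for \<phi>
  proof -
    have "g * cis \<phi> = rcis (cmod g) (Arg g + \<phi>)"
      by (metis cis_mult mult.assoc rcis_cmod_Arg rcis_def)
    then show ?thesis by simp
  qed
  show "Im g = 0 \<and> Re g \<ge> 0"
  proof (cases "g = 0")
    case False
    note b = Arg_bounded[of g]
    \<comment> \<open>Rotating by half of -Arg g leaves g in the open lower half-plane.\<close>
    have "\<not> Arg g < 0"
    proof
      assume "Arg g < 0"
      then have "0 \<le> cmod g * sin (Arg g + - (Arg g / 2))"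
        using im[of "- (Arg g / 2)"] b m unfolding e by simp
      moreover have "sin (- (Arg g / 2)) > 0" using \<open>Arg g < 0\<close> b by (intro sin_gt_zero) auto
      ultimately show False using False by (simp add: zero_le_mult_iff)
    qed
    \<comment> \<open>Rotating by pi - Arg g / 2 carries g past the negative axis into the open
      lower half-plane.\<close>
    moreover have "\<not> Arg g > 0"
    proof
      assume "Arg g > 0"
      then have "0 \<le> cmod g * sin (Arg g + (pi - Arg g / 2))"
        using im[of "pi - Arg g / 2"] b m unfolding e by simp
      also have "Arg g + (pi - Arg g / 2) = Arg g / 2 + pi" by simp
      finally have "0 \<le> cmod g * sin (Arg g / 2 + pi)" .
      moreover have "sin (Arg g / 2) > 0" using \<open>Arg g > 0\<close> b by (intro sin_gt_zero) auto
      ultimately show False using False by (simp add: mult_le_0_iff)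
    qed
    ultimately have "Arg g = 0" by linarith
    then have "g = complex_of_real (cmod g)" using rcis_cmod_Arg[of g] by simp
    then show ?thesis by (metis Im_complex_of_real Re_complex_of_real norm_ge_zero)
  qed simp
qed

text \<open>The limit hypothesis says that F behaves like g / (z - r)^m along every ray entering the
  upper half-plane at the real point r. The sign for m = 1 is that of -1/z, which preserves the
  upper half-plane.\<close>

lemma halfplane_pole:
  fixes F :: "complex \<Rightarrow> complex" and r :: real
  assumes "m \<ge> 1" and im: "\<And>z. Im z > 0 \<Longrightarrow> Im (F z) \<ge> 0"
    and lim: "\<And>\<theta>. 0 < \<theta> \<Longrightarrow> \<theta> < pi \<Longrightarrow>
      (\<lambda>n. complex_of_real (1 / Suc n) ^ m * F (complex_of_real r + complex_of_real (1 / Suc n) * cis \<theta>))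
        \<longlonglongrightarrow> g * cis (- (real m * \<theta>))"
  shows "m \<ge> 2 \<Longrightarrow> g = 0" "m = 1 \<Longrightarrow> Im g = 0 \<and> Re g \<le> 0"
proof -
  have im_scale: "Im (complex_of_real x ^ k * w) = x ^ k * Im w" for x k w
    by (simp flip: of_real_power)
  \<comment> \<open>The limits rotate g clockwise; since Im (- cnj w) = Im w, passing to - cnj g
    turns this into the anticlockwise sweep of \<open>halfplane_cone\<close>.\<close>
  have "Im ((- cnj g) * cis \<phi>) \<ge> 0" if "0 < \<phi>" "\<phi> < real m * pi" for \<phi>
  proof -
    have \<theta>: "0 < \<phi> / m" "\<phi> / m < pi" using that assms(1) by (auto simp: field_simps)
    have "0 \<le> Im (g * cis (- (real m * (\<phi> / m))))"
    proof (rule tendsto_lowerbound[OF tendsto_Im[OF lim[OF \<theta>]]])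
      show "\<forall>\<^sub>F n in sequentially. 0 \<le> Im (complex_of_real (1 / Suc n) ^ m *
              F (complex_of_real r + complex_of_real (1 / Suc n) * cis (\<phi> / m)))"
      proof (rule always_eventually, rule allI)
        fix n
        have "Im (complex_of_real r + complex_of_real (1 / Suc n) * cis (\<phi> / m)) > 0"
          using sin_gt_zero[OF \<theta>] by simp
        then have "0 \<le> (1 / Suc n) ^ m * Im (F (complex_of_real r + complex_of_real (1 / Suc n) * cis (\<phi> / m)))"
          by (intro mult_nonneg_nonneg im) auto
        then show "0 \<le> Im (complex_of_real (1 / Suc n) ^ m *
              F (complex_of_real r + complex_of_real (1 / Suc n) * cis (\<phi> / m)))"
          by (simp only: im_scale)
      qed
    qed simp
    also have "real m * (\<phi> / m) = \<phi>" using assms(1) by simp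
    finally show ?thesis by (simp add: algebra_simps)
  qed
  from halfplane_cone[OF assms(1) this]
  show "m \<ge> 2 \<Longrightarrow> g = 0" "m = 1 \<Longrightarrow> Im g = 0 \<and> Re g \<le> 0" by auto
qed

text \<open>Adding a root r0 divides by z - r0. The polynomial part splits by synthetic division,
  with remainder \<open>poly s r0\<close>, and each old term by 1/((z - r)(z - r0)) = (1/(z - r) -
  1/(z - r0)) / (r - r0). The new coefficient at r0 collects the remainder and the subtracted
  terms.\<close>

lemma partial_fractions_simple:
  fixes Z :: "'a :: field set"
  assumes "finite Z"
  shows "\<exists>s c. \<forall>z. z \<notin> Z \<longrightarrow> poly p z / (\<Prod>r\<in>Z. z - r) = poly s z + (\<Sum>r\<in>Z. c r / (z - r))"
  using assms
proof (induction Z)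
  case empty
  show ?case by (rule exI[of _ p]) simp
next
  case (insert r0 Z)
  then obtain s c where sc: "\<And>z. z \<notin> Z \<Longrightarrow> poly p z / (\<Prod>r\<in>Z. z - r) = poly s z + (\<Sum>r\<in>Z. c r / (z - r))"
    by blast
  define c' where "c' r = (if r = r0 then poly s r0 - (\<Sum>r\<in>Z. c r / (r - r0)) else c r / (r - r0))" for r
  have "poly p z / (\<Prod>r\<in>insert r0 Z. z - r) = poly (synthetic_div s r0) z + (\<Sum>r\<in>insert r0 Z. c' r / (z - r))"
    if z: "z \<notin> insert r0 Z" for z
  proof -
    have "poly s z = poly ([:-r0, 1:] * synthetic_div s r0 + [:poly s r0:]) z"
      by (simp only: synthetic_div_correct')
    then have s: "poly s z / (z - r0) = poly (synthetic_div s r0) z + poly s r0 / (z - r0)"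
      using z by (simp add: field_simps)
    have t: "c r / (z - r) / (z - r0) = c r / (r - r0) / (z - r) - c r / (r - r0) / (z - r0)" if "r \<in> Z" for r
    proof -
      have nz: "z - r \<noteq> 0" "z - r0 \<noteq> 0" "r - r0 \<noteq> 0" using that z insert.hyps by auto
      have "c r / (r - r0) / (z - r) - c r / (r - r0) / (z - r0) =
          c r / (r - r0) * (1 / (z - r) - 1 / (z - r0))"
        by (simp add: right_diff_distrib)
      also have "1 / (z - r) - 1 / (z - r0) = (r - r0) / ((z - r) * (z - r0))"
        using nz by (simp add: diff_frac_eq)
      finally show ?thesis using nz by simp
    qed
    have "poly p z / (\<Prod>r\<in>insert r0 Z. z - r) = (poly p z / (\<Prod>r\<in>Z. z - r)) / (z - r0)"
      using insert.hyps by simp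
    also have "\<dots> = poly s z / (z - r0) + (\<Sum>r\<in>Z. c r / (z - r) / (z - r0))"
      using sc[of z] z by (simp add: add_divide_distrib sum_divide_distrib)
    also have "(\<Sum>r\<in>Z. c r / (z - r) / (z - r0)) =
        (\<Sum>r\<in>Z. c r / (r - r0) / (z - r)) - (\<Sum>r\<in>Z. c r / (r - r0)) / (z - r0)"
      unfolding sum_divide_distrib sum_subtractf[symmetric] by (rule sum.cong[OF refl t])
    also have "(\<Sum>r\<in>Z. c r / (r - r0) / (z - r)) = (\<Sum>r\<in>Z. c' r / (z - r))"
      using insert.hyps by (intro sum.cong) (auto simp: c'_def)
    finally show ?thesis
      using insert.hyps by (simp add: s c'_def diff_divide_distrib)
  qed
  then show ?case by blast
qed

text \<open>Values on the half-line are left unconstrained, since that is where the poles lie. The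
  fraction may be unreduced, so closure under arithmetic only multiplies denominators.\<close>

definition slit_rational :: "(complex \<Rightarrow> complex) \<Rightarrow> bool" where
  "slit_rational f \<longleftrightarrow> (\<exists>p q. \<forall>z. z \<notin> \<real>\<^sub>\<ge>\<^sub>0 \<longrightarrow> poly q z \<noteq> 0 \<and> f z = poly p z / poly q z)"

lemma slit_rationalI:
  "(\<And>z. z \<notin> \<real>\<^sub>\<ge>\<^sub>0 \<Longrightarrow> poly q z \<noteq> 0 \<and> f z = poly p z / poly q z) \<Longrightarrow> slit_rational f"
  by (auto simp: slit_rational_def)

lemma slit_rational_const [intro]: "slit_rational (\<lambda>_. c)"
  by (rule slit_rationalI[of 1 _ "[:c:]"]) simp

lemma slit_rational_id [intro]: "slit_rational (\<lambda>z. z)"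
  by (rule slit_rationalI[of 1 _ "[:0, 1:]"]) simp

lemma slit_rational_add [intro]:
  assumes "slit_rational f" "slit_rational g"
  shows "slit_rational (\<lambda>z. f z + g z)"
proof -
  obtain p q p' q' where "\<And>z. z \<notin> \<real>\<^sub>\<ge>\<^sub>0 \<Longrightarrow> poly q z \<noteq> 0 \<and> f z = poly p z / poly q z"
    "\<And>z. z \<notin> \<real>\<^sub>\<ge>\<^sub>0 \<Longrightarrow> poly q' z \<noteq> 0 \<and> g z = poly p' z / poly q' z"
    using assms unfolding slit_rational_def by blast
  then show ?thesis
    by (intro slit_rationalI[of "q * q'" _ "p * q' + p' * q"]) (auto simp: field_simps)
qed

lemma slit_rational_mult [intro]:
  assumes "slit_rational f" "slit_rational g"
  shows "slit_rational (\<lambda>z. f z * g z)"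
proof -
  obtain p q p' q' where "\<And>z. z \<notin> \<real>\<^sub>\<ge>\<^sub>0 \<Longrightarrow> poly q z \<noteq> 0 \<and> f z = poly p z / poly q z"
    "\<And>z. z \<notin> \<real>\<^sub>\<ge>\<^sub>0 \<Longrightarrow> poly q' z \<noteq> 0 \<and> g z = poly p' z / poly q' z"
    using assms unfolding slit_rational_def by blast
  then show ?thesis
    by (intro slit_rationalI[of "q * q'" _ "p * p'"]) auto
qed

lemma slit_rational_divide [intro]:
  assumes "slit_rational f" "slit_rational g" "\<And>z. z \<notin> \<real>\<^sub>\<ge>\<^sub>0 \<Longrightarrow> g z \<noteq> 0"
  shows "slit_rational (\<lambda>z. f z / g z)"
proof -
  obtain p q p' q' where *: "\<And>z. z \<notin> \<real>\<^sub>\<ge>\<^sub>0 \<Longrightarrow> poly q z \<noteq> 0 \<and> f z = poly p z / poly q z"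
    "\<And>z. z \<notin> \<real>\<^sub>\<ge>\<^sub>0 \<Longrightarrow> poly q' z \<noteq> 0 \<and> g z = poly p' z / poly q' z"
    using assms unfolding slit_rational_def by blast
  then show ?thesis using assms(3)
    by (intro slit_rationalI[of "q * p'" _ "p * q'"]) (auto simp: *)
qed

lemma slit_rational_diff [intro]:
  assumes "slit_rational f" "slit_rational g"
  shows "slit_rational (\<lambda>z. f z - g z)"
proof -
  have "slit_rational (\<lambda>z. f z + (-1) * g z)"
    by (intro slit_rational_add slit_rational_mult slit_rational_const assms)
  then show ?thesis by simp
qed

lemma slit_rational_sum [intro]:
  "(\<And>i. i \<in> I \<Longrightarrow> slit_rational (f i)) \<Longrightarrow> slit_rational (\<lambda>z. \<Sum>i\<in>I. f i z)"
  by (induction I rule: infinite_finite_induct) auto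

lemma slit_rational_cong:
  assumes "slit_rational f" "\<And>z. z \<notin> \<real>\<^sub>\<ge>\<^sub>0 \<Longrightarrow> f z = g z"
  shows "slit_rational g"
proof -
  obtain p q where "\<And>z. z \<notin> \<real>\<^sub>\<ge>\<^sub>0 \<Longrightarrow> poly q z \<noteq> 0 \<and> f z = poly p z / poly q z"
    using assms(1) unfolding slit_rational_def by blast
  then show ?thesis using assms(2) by (intro slit_rationalI[of q _ p]) simp
qed

text \<open>Choose a representation with denominator of least degree: a common root could be
  cancelled from both polynomials, lowering the degree.\<close>

lemma slit_rational_reduced:
  assumes "slit_rational F"
  shows "\<exists>p q. (\<forall>z. z \<notin> \<real>\<^sub>\<ge>\<^sub>0 \<longrightarrow> poly q z \<noteq> 0 \<and> F z = poly p z / poly q z) \<and>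
    (\<forall>z. poly q z = 0 \<longrightarrow> poly p z \<noteq> 0)"
proof -
  define R where "R p q \<longleftrightarrow> (\<forall>z. z \<notin> \<real>\<^sub>\<ge>\<^sub>0 \<longrightarrow> poly q z \<noteq> 0 \<and> F z = poly p z / poly q z)" for p q
  obtain pq where pq: "R (fst pq) (snd pq)" 
    and min: "\<And>p' q'. R p' q' \<Longrightarrow> degree (snd pq) \<le> degree q'"
    using ex_has_least_nat[of "\<lambda>pq. R (fst pq) (snd pq)" _ "\<lambda>pq. degree (snd pq)"] assms
    unfolding slit_rational_def R_def[symmetric] by (metis fst_conv snd_conv)
  have "poly (fst pq) r \<noteq> 0" if "poly (snd pq) r = 0" for r
  proof
    assume "poly (fst pq) r = 0"
    from this obtain p' where p': "fst pq = [:-r, 1:] * p'" unfolding poly_eq_0_iff_dvd dvd_def by blast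
    from that obtain q' where q': "snd pq = [:-r, 1:] * q'" unfolding poly_eq_0_iff_dvd dvd_def by blast
    have "R p' q'"
      unfolding R_def
    proof (intro allI impI)
      fix z :: complex
      assume "z \<notin> \<real>\<^sub>\<ge>\<^sub>0"
      then have "poly [:-r, 1:] z * poly q' z \<noteq> 0"
        "F z = (poly [:-r, 1:] z * poly p' z) / (poly [:-r, 1:] z * poly q' z)"
        using pq unfolding R_def p' q' poly_mult by blast+
      then show "poly q' z \<noteq> 0 \<and> F z = poly p' z / poly q' z" by simp
    qed
    then have "degree (snd pq) \<le> degree q'" by (rule min)
    \<comment> \<open>The zero polynomial would vanish at -1, a point off the half-line.\<close>
    moreover have "q' \<noteq> 0" using \<open>R p' q'\<close> nonneg_Reals_minus_one_I unfolding R_def by fastforce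
    then have "degree (snd pq) = Suc (degree q')" unfolding q' by (subst degree_mult_eq) auto
    ultimately show False by simp
  qed
  with pq show ?thesis unfolding R_def by blast
qed

section \<open>Boundary behaviour along rays\<close>

abbreviation inv_Suc :: "nat \<Rightarrow> complex" where
  "inv_Suc n \<equiv> complex_of_real (1 / Suc n)"

lemma inv_Suc_tendsto: "inv_Suc \<longlonglongrightarrow> 0"
  using tendsto_of_real[OF LIMSEQ_inverse_real_of_nat, where 'a = complex]
  by (simp only: inverse_eq_divide of_real_0)

lemma Re_inv_Suc_pos: "Re (inv_Suc n) > 0" and inv_Suc_nonzero: "inv_Suc n \<noteq> 0"
  unfolding Re_complex_of_real of_real_eq_0_iff by (auto simp del: of_nat_Suc)

lemma Im_ray_pos:
  assumes "0 < \<theta>" "\<theta> < pi"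
  shows "Im (complex_of_real x + inv_Suc n * cis \<theta>) > 0"
proof -
  have "Im (complex_of_real x + inv_Suc n * cis \<theta>) = 1 / Suc n * sin \<theta>"
    by (simp only: plus_complex.sel times_complex.sel Im_complex_of_real Re_complex_of_real cis.sel mult_zero_left add_0_left add_0_right)
  then show ?thesis using sin_gt_zero[OF assms] by (simp only:) simp
qed

lemma ray_tendsto: "(\<lambda>n. r + inv_Suc n * w) \<longlonglongrightarrow> r"
  using tendsto_add[OF tendsto_const tendsto_mult[OF inv_Suc_tendsto tendsto_const], of r w]
  by (simp only: mult_zero_left add_0_right)

text \<open>If q = (z - r)^m q1 with q1(r) nonzero, then F behaves like (p(r) / q1(r)) / (z - r)^m
  near r. For m \<ge> 2 the half-plane condition forces this coefficient to vanish, although p(r)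
  does not.\<close>

lemma halfplane_rational_pole_order:
  fixes \<rho> :: real
  assumes F: "\<And>z. Im z > 0 \<Longrightarrow> poly q z \<noteq> 0 \<and> F z = poly p z / poly q z"
    and upper: "\<And>z. Im z > 0 \<Longrightarrow> Im (F z) \<ge> 0"
    and "q \<noteq> 0" "poly p (complex_of_real \<rho>) \<noteq> 0"
  shows "order (complex_of_real \<rho>) q \<le> 1"
proof (rule ccontr)
  define r where "r = complex_of_real \<rho>"
  define m where "m = order r q"
  assume "\<not> order (complex_of_real \<rho>) q \<le> 1"
  then have m: "m \<ge> 2" by (simp add: m_def r_def)
  obtain q1 where q1: "q = [:- r, 1:] ^ m * q1" "poly q1 r \<noteq> 0"
    using order_decomp[OF \<open>q \<noteq> 0\<close>, of r] unfolding m_def poly_eq_0_iff_dvd by blast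
  have "poly p r / poly q1 r = 0"
  proof (rule halfplane_pole(1)[of m F \<rho>])
    fix \<theta> :: real assume \<theta>: "0 < \<theta>" "\<theta> < pi"
    define z where "z n = r + inv_Suc n * cis \<theta>" for n
    have z: "Im (z n) > 0" for n using Im_ray_pos[OF \<theta>] by (simp only: z_def r_def)
    have "z \<longlonglongrightarrow> r" unfolding z_def by (rule ray_tendsto)
    then have "(\<lambda>n. poly p (z n) / poly q1 (z n) * cis (- (real m * \<theta>))) \<longlonglongrightarrow>
        poly p r / poly q1 r * cis (- (real m * \<theta>))"
      using q1(2) by (intro tendsto_intros) auto
    moreover have "poly p (z n) / poly q1 (z n) * cis (- (real m * \<theta>)) = inv_Suc n ^ m * F (z n)" for n
    proof -
      have "poly q (z n) = (inv_Suc n * cis \<theta>) ^ m * poly q1 (z n)"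
        by (simp add: q1(1) z_def poly_power)
      also have "\<dots> = inv_Suc n ^ m * cis (real m * \<theta>) * poly q1 (z n)"
        by (simp only: power_mult_distrib Complex.DeMoivre)
      finally have Fz: "F (z n) = poly p (z n) / (inv_Suc n ^ m * cis (real m * \<theta>) * poly q1 (z n))"
        using F[OF z[of n]] by simp
      have cis: "cis (- (real m * \<theta>)) = 1 / cis (real m * \<theta>)"
        by (simp add: cis_inverse[symmetric] inverse_eq_divide)
      have "a / b * (1 / c) = e * (a / (e * c * b))" if "e \<noteq> 0" for a b c e :: complex
        using that by simp
      from this[OF power_not_zero[OF inv_Suc_nonzero]] show ?thesis unfolding Fz cis .
    qed
    ultimately show "(\<lambda>n. inv_Suc n ^ m * F (complex_of_real \<rho> + inv_Suc n * cis \<theta>)) \<longlonglongrightarrow>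
        poly p r / poly q1 r * cis (- (real m * \<theta>))"
      unfolding r_def[symmetric] z_def[symmetric] by simp
  qed (use m upper in auto)
  then show False using assms(4) q1(2) by (simp add: r_def)
qed

text \<open>Scaling by the distance to the pole along a ray removes the regular part h in the limit
  and leaves the rotated residue.\<close>

lemma halfplane_simple_pole_residue:
  fixes \<rho> :: real
  assumes F: "\<And>z. Im z > 0 \<Longrightarrow> F z = h z + c / (z - complex_of_real \<rho>)"
    and upper: "\<And>z. Im z > 0 \<Longrightarrow> Im (F z) \<ge> 0"
    and h: "isCont h (complex_of_real \<rho>)"
  shows "Im c = 0 \<and> Re c \<le> 0"
proof (rule halfplane_pole(2)[of 1 F \<rho>])
  fix \<theta> :: real assume \<theta>: "0 < \<theta>" "\<theta> < pi"
  define z where "z n = complex_of_real \<rho> + inv_Suc n * cis \<theta>" for n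
  have z: "Im (z n) > 0" for n using Im_ray_pos[OF \<theta>] by (simp only: z_def)
  have "z \<longlonglongrightarrow> complex_of_real \<rho>" unfolding z_def by (rule ray_tendsto)
  then have "(\<lambda>n. h (z n)) \<longlonglongrightarrow> h (complex_of_real \<rho>)" by (rule isCont_tendsto_compose[OF h])
  then have "(\<lambda>n. inv_Suc n * h (z n) + c * cis (- \<theta>)) \<longlonglongrightarrow> 0 * h (complex_of_real \<rho>) + c * cis (- \<theta>)"
    by (intro tendsto_add tendsto_mult tendsto_const inv_Suc_tendsto)
  moreover have "inv_Suc n * h (z n) + c * cis (- \<theta>) = inv_Suc n ^ 1 * F (z n)" for n
  proof -
    have "c / (z n - complex_of_real \<rho>) = c * cis (- \<theta>) / inv_Suc n"
      unfolding z_def add_diff_cancel_left' cis_inverse[symmetric] by (simp only: divide_inverse inverse_mult_distrib mult_ac)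
    then show ?thesis
      unfolding F[OF z] using inv_Suc_nonzero[of n] by (simp only: power_one_right distrib_left) simp
  qed
  ultimately show "(\<lambda>n. inv_Suc n ^ 1 * F (complex_of_real \<rho> + inv_Suc n * cis \<theta>)) \<longlonglongrightarrow> c * cis (- (real 1 * \<theta>))"
    unfolding z_def[symmetric] by simp
qed (use upper in auto)

text \<open>The counterpart at infinity of the pole argument: along rays z F(z) grows like the
  leading coefficient times z^(d+1), so \<open>halfplane_cone\<close> forces d + 1 = 1.\<close>

lemma halfplane_polynomial_part:
  assumes F: "\<And>z. Im z > 0 \<Longrightarrow> F z = poly s z + h z"
    and upper: "\<And>z. Im z > 0 \<Longrightarrow> Im (z * F z) \<ge> 0"
    and h: "(h \<longlongrightarrow> 0) at_infinity"
  shows "\<exists>a\<ge>0. s = [:complex_of_real a:]"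
proof -
  define d where "d = degree s"
  \<comment> \<open>The arc has length (d + 1) pi rather than d pi because the condition concerns z
    F(z); hence even linear growth of F is excluded.\<close>
  have cone: "Im (lead_coeff s * cis \<phi>) \<ge> 0" if \<phi>: "0 < \<phi>" "\<phi> < real (Suc d) * pi" for \<phi>
  proof -
    define \<theta> where "\<theta> = \<phi> / Suc d"
    have \<theta>: "0 < \<theta>" "\<theta> < pi" using \<phi> by (auto simp: \<theta>_def field_simps)
    define z where "z n = complex_of_real (Suc n) * cis \<theta>" for n
    have Imz: "Im (z n) > 0" for n using sin_gt_zero[OF \<theta>] by (simp add: z_def)
    have znz: "z n \<noteq> 0" for n using Imz[of n] by auto
    have zinf: "filterlim z at_infinity sequentially"
    proof (rule filterlim_norm_at_top_imp_at_infinity)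
      have "norm (z n) = real (Suc n)" for n by (simp add: z_def norm_mult del: of_nat_Suc)
      then show "filterlim (\<lambda>n. norm (z n)) at_top sequentially"
        using filterlim_compose[OF filterlim_real_sequentially filterlim_Suc] by simp
    qed
    have "(\<lambda>n. poly s (z n) / z n ^ d) \<longlonglongrightarrow> lead_coeff s"
      unfolding d_def by (rule filterlim_compose[OF poly_divide_tendsto_aux zinf])
    moreover have "(\<lambda>n. h (z n) * (1 / z n) ^ d) \<longlonglongrightarrow> 0 * 0 ^ d"
      by (intro tendsto_mult tendsto_power filterlim_compose[OF h zinf] tendsto_divide_0[OF tendsto_const zinf])
    ultimately have "(\<lambda>n. poly s (z n) / z n ^ d + h (z n) * (1 / z n) ^ d) \<longlonglongrightarrow> lead_coeff s + 0 * 0 ^ d"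
      by (rule tendsto_add)
    moreover have "poly s (z n) / z n ^ d + h (z n) * (1 / z n) ^ d = F (z n) / z n ^ d" for n
      unfolding F[OF Imz] by (simp add: add_divide_distrib power_divide)
    ultimately have "(\<lambda>n. F (z n) / z n ^ d) \<longlonglongrightarrow> lead_coeff s" by simp
    then have "(\<lambda>n. Im (F (z n) / z n ^ d * cis \<phi>)) \<longlonglongrightarrow> Im (lead_coeff s * cis \<phi>)"
      by (intro tendsto_Im tendsto_mult tendsto_const)
    moreover have "Im (F (z n) / z n ^ d * cis \<phi>) \<ge> 0" for n
    proof -
      \<comment> \<open>Up to a positive factor \<open>cis \<phi>\<close> is
        \<open>z n ^ Suc d\<close>, so the whole expression is a positive multiple of
        \<open>z n * F (z n)\<close>.\<close>
      have "cis \<phi> = cis \<theta> ^ Suc d" unfolding \<theta>_def Complex.DeMoivre by simp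
      also have "\<dots> = z n ^ Suc d / complex_of_real (Suc n ^ Suc d)"
        by (simp add: z_def power_mult_distrib del: of_nat_Suc power_Suc)
      finally have "F (z n) / z n ^ d * cis \<phi> = z n * F (z n) / complex_of_real (Suc n ^ Suc d)"
        using znz[of n] by (simp only:) simp
      then show ?thesis using upper[OF Imz[of n]]
        by (simp only: Im_divide_of_real) (intro divide_nonneg_nonneg, auto)
    qed
    ultimately show ?thesis by (intro tendsto_lowerbound[of _ _ sequentially 0]) auto
  qed
  have "d = 0"
  proof (rule ccontr)
    assume "d \<noteq> 0"
    then have "lead_coeff s = 0" using halfplane_cone(1)[of "Suc d", OF _ cone] by simp
    then show False using \<open>d \<noteq> 0\<close> by (simp add: d_def)
  qed
  then obtain b where b: "s = [:b:]" by (metis d_def degree_eq_zeroE)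
  have "Im b = 0 \<and> Re b \<ge> 0"
    using halfplane_cone(2)[of "Suc d", OF _ cone] \<open>d = 0\<close> b by simp
  then have "b = complex_of_real (Re b)" "Re b \<ge> 0" by (auto simp: complex_eq_iff)
  then show ?thesis unfolding b by metis
qed

text \<open>A term c/(z - r) with r > 0 and c \<le> 0 equals (-c/r) / (1 - z/r): an atom of mass
  -c/r at 1/r. The constant part is the atom at 0, and the limit at 0 fixes the total mass.\<close>

theorem slit_rational_stieltjes:
  assumes rat: "slit_rational F"
    and upper: "\<And>z. Im z > 0 \<Longrightarrow> Im (F z) \<ge> 0" "\<And>z. Im z > 0 \<Longrightarrow> Im (z * F z) \<ge> 0"
    and lim: "(\<lambda>n. F (- inv_Suc n)) \<longlonglongrightarrow> 1"
  shows "\<exists>V c. finite V \<and> (\<forall>t\<in>V. 0 \<le> t \<and> 0 \<le> c t) \<and> sum c V = 1 \<and>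
    (\<forall>z. z \<notin> \<real>\<^sub>\<ge>\<^sub>0 \<longrightarrow> F z = (\<Sum>t\<in>V. complex_of_real (c t) / (1 - z * complex_of_real t)))"
proof -
  obtain p q where pq: "\<And>z. z \<notin> \<real>\<^sub>\<ge>\<^sub>0 \<Longrightarrow> poly q z \<noteq> 0 \<and> F z = poly p z / poly q z"
    and coprime: "\<And>z. poly q z = 0 \<Longrightarrow> poly p z \<noteq> 0"
    using slit_rational_reduced[OF rat] by metis
  have neg_slit: "- inv_Suc n \<notin> \<real>\<^sub>\<ge>\<^sub>0" for n
    using Re_inv_Suc_pos[of n] by (simp only: slit_iff uminus_complex.sel) simp
  have up_slit: "z \<notin> \<real>\<^sub>\<ge>\<^sub>0" if "Im z > 0" for z using that by (auto simp: slit_iff)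

  \<comment> \<open>With q(0) = 0, the finite limit of F = p/q at 0 would force p(0) = 0 as well,
    against reducedness.\<close>
  have "poly q 0 \<noteq> 0"
  proof
    assume q0: "poly q 0 = 0"
    have "(\<lambda>n. poly q (- inv_Suc n) * F (- inv_Suc n)) \<longlonglongrightarrow> poly q (- 0) * 1"
      by (intro tendsto_mult tendsto_poly tendsto_minus inv_Suc_tendsto lim)
    moreover have "poly q (- inv_Suc n) * F (- inv_Suc n) = poly p (- inv_Suc n)" for n
      using pq[OF neg_slit[of n]] by simp
    moreover have "(\<lambda>n. poly p (- inv_Suc n)) \<longlonglongrightarrow> poly p (- 0)"
      by (intro tendsto_poly tendsto_minus inv_Suc_tendsto)
    ultimately have "poly p (- 0) = poly q (- 0) * 1" using LIMSEQ_unique by simp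
    with coprime q0 show False by simp
  qed
  then have "q \<noteq> 0" by auto
  define Z where "Z = {r. poly q r = 0}"
  have finZ: "finite Z" unfolding Z_def by (rule poly_roots_finite) fact
  have root: "r = complex_of_real (Re r)" "Re r > 0" if "r \<in> Z" for r
  proof -
    have "r \<in> \<real>\<^sub>\<ge>\<^sub>0" "r \<noteq> 0" using pq[of r] that \<open>poly q 0 \<noteq> 0\<close> by (auto simp: Z_def)
    then show "r = complex_of_real (Re r)" "Re r > 0"
      by (auto simp: complex_nonneg_Reals_iff complex_eq_iff less_le)
  qed
  have order_le: "order r q \<le> 1" if "r \<in> Z" for r
  proof -
    have "order (complex_of_real (Re r)) q \<le> 1"
      using coprime[of r] root(1)[OF that] that \<open>q \<noteq> 0\<close>
      by (intro halfplane_rational_pole_order[of q F p] pq upper up_slit) (auto simp: Z_def)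
    then show ?thesis using root(1)[OF that] by simp
  qed
  have "rsquarefree q"
    unfolding rsquarefree_def
  proof (intro conjI allI)
    fix r show "order r q = 0 \<or> order r q = 1"
      using order_le[of r] order_root[of q r] by (cases "r \<in> Z") (auto simp: Z_def)
  qed fact
  from complex_poly_decompose_rsquarefree[OF this]
  have "poly q z = poly (smult (lead_coeff q) (\<Prod>r\<in>Z. [:- r, 1:])) z" for z
    by (simp add: Z_def)
  then have q_prod: "poly q z = lead_coeff q * (\<Prod>r\<in>Z. z - r)" for z
    by (simp add: poly_prod)
  obtain s c where sc: "\<And>z. z \<notin> Z \<Longrightarrow>
      poly (smult (1 / lead_coeff q) p) z / (\<Prod>r\<in>Z. z - r) = poly s z + (\<Sum>r\<in>Z. c r / (z - r))"
    using partial_fractions_simple[OF finZ, of "smult (1 / lead_coeff q) p"] by blast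
  have F: "F z = poly s z + (\<Sum>r\<in>Z. c r / (z - r))" if "z \<notin> \<real>\<^sub>\<ge>\<^sub>0" for z
  proof -
    have "z \<notin> Z" using pq[OF that] by (simp add: Z_def)
    have "F z = poly p z / (lead_coeff q * (\<Prod>r\<in>Z. z - r))" using pq[OF that] by (simp only: q_prod)
    also have "\<dots> = poly (smult (1 / lead_coeff q) p) z / (\<Prod>r\<in>Z. z - r)" by simp
    finally show ?thesis using sc[OF \<open>z \<notin> Z\<close>] by (simp only:)
  qed

  have c: "Im (c r) = 0 \<and> Re (c r) \<le> 0" if r: "r \<in> Z" for r
  proof (rule halfplane_simple_pole_residue[of F "\<lambda>z. poly s z + (\<Sum>j\<in>Z - {r}. c j / (z - j))" _ "Re r"])
    show "F z = poly s z + (\<Sum>j\<in>Z - {r}. c j / (z - j)) + c r / (z - complex_of_real (Re r))"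
      if "Im z > 0" for z
      unfolding F[OF up_slit[OF that]] sum.remove[OF finZ r] root(1)[OF r, symmetric] by simp
    show "isCont (\<lambda>z. poly s z + (\<Sum>j\<in>Z - {r}. c j / (z - j))) (complex_of_real (Re r))"
      unfolding root(1)[OF r, symmetric] by (intro continuous_intros) auto
  qed (rule upper)

  have "((\<lambda>z. \<Sum>r\<in>Z. c r / (z - r)) \<longlongrightarrow> (\<Sum>r\<in>Z. 0)) at_infinity"
  proof (rule tendsto_sum)
    fix r :: complex
    have "filterlim (\<lambda>z. z - r) at_infinity at_infinity"
      using tendsto_add_filterlim_at_infinity'[OF filterlim_ident tendsto_const[of "- r"]] by simp
    then show "((\<lambda>z. c r / (z - r)) \<longlongrightarrow> 0) at_infinity"
      by (rule tendsto_divide_0[OF tendsto_const])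
  qed
  then obtain a where a: "a \<ge> 0" "s = [:complex_of_real a:]"
    using halfplane_polynomial_part[of F s, OF F[OF up_slit] upper(2)] by fastforce

  define T where "T r = 1 / Re r" for r :: complex
  have injT: "inj_on T Z"
  proof (rule inj_onI)
    fix r r' assume h: "r \<in> Z" "r' \<in> Z" "T r = T r'"
    then have "Re r = Re r'" by (simp add: T_def)
    then show "r = r'" using root(1)[OF h(1)] root(1)[OF h(2)] by simp
  qed
  have Tpos: "T r > 0" if "r \<in> Z" for r using root(2)[OF that] by (simp add: T_def)
  \<comment> \<open>For t = 1/r this is -Re (c r) / r written in terms of t.\<close>
  define w where "w t = (if t = 0 then a else - Re (c (complex_of_real (1 / t))) * t)" for t
  define V where "V = insert 0 (T ` Z)"
  have wT: "w (T r) = - Re (c r) / Re r" if "r \<in> Z" for r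
    using root[OF that] by (simp add: w_def T_def)
  have V: "finite V" "\<forall>t\<in>V. 0 \<le> t \<and> 0 \<le> w t"
  proof -
    show "finite V" using finZ by (simp add: V_def)
    have "0 \<le> w (T r)" if "r \<in> Z" for r
      unfolding wT[OF that] using c[OF that] root(2)[OF that] by (simp add: divide_nonpos_pos)
    then show "\<forall>t\<in>V. 0 \<le> t \<and> 0 \<le> w t"
      using Tpos a(1) by (auto simp: V_def less_imp_le) (simp add: w_def)
  qed
  have FV: "F z = (\<Sum>t\<in>V. complex_of_real (w t) / (1 - z * complex_of_real t))" if z: "z \<notin> \<real>\<^sub>\<ge>\<^sub>0" for z
  proof -
    have "c r / (z - r) = complex_of_real (w (T r)) / (1 - z * complex_of_real (T r))" if "r \<in> Z" for r
    proof -
      define x b where "x = Re r" and "b = Re (c r)"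
      have "c r = complex_of_real b" using c[OF that] by (simp add: complex_eq_iff b_def)
      moreover have x: "r = complex_of_real x" "x > 0" using root[OF that] by (auto simp: x_def)
      moreover have "z - complex_of_real x \<noteq> 0" using z x by auto
      moreover have "1 - z * complex_of_real (1 / x) \<noteq> 0"
        using resolvent_nonzero[OF z, of "1 / x"] x by simp
      ultimately show ?thesis unfolding wT[OF that] unfolding T_def x_def[symmetric] b_def[symmetric]
        by (simp add: field_simps)
    qed
    then have "F z = complex_of_real a + (\<Sum>r\<in>Z. complex_of_real (w (T r)) / (1 - z * complex_of_real (T r)))"
      unfolding F[OF z] a(2) by simp
    also have "\<dots> = (\<Sum>t\<in>V. complex_of_real (w t) / (1 - z * complex_of_real t))"
    proof -
      have "0 \<notin> T ` Z" using Tpos by force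
      then show ?thesis
        using finZ unfolding V_def by (simp add: sum.reindex[OF injT]) (simp add: w_def)
    qed
    finally show ?thesis .
  qed
  \<comment> \<open>Letting z tend to 0 in the finite sum leaves the total mass, to be compared with
    the prescribed limit 1.\<close>
  have "(\<lambda>n. \<Sum>t\<in>V. complex_of_real (w t) / (1 - (- inv_Suc n) * complex_of_real t)) \<longlonglongrightarrow>
      (\<Sum>t\<in>V. complex_of_real (w t) / (1 - (- 0) * complex_of_real t))"
    by (intro tendsto_sum tendsto_divide tendsto_diff tendsto_mult tendsto_minus tendsto_const inv_Suc_tendsto) auto
  then have "(\<lambda>n. F (- inv_Suc n)) \<longlonglongrightarrow> complex_of_real (sum w V)"
    unfolding FV[OF neg_slit] by simp
  then have "complex_of_real (sum w V) = 1" using lim by (rule LIMSEQ_unique)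
  then have "sum w V = 1" by (simp only: of_real_eq_1_iff)
  with V FV show ?thesis by blast
qed

section \<open>Limits of resolvent means\<close>

lemma prob_measure_RplusD: "prob_measure_Rplus \<mu> \<Longrightarrow> Rplus_prob \<mu>"
  by (simp add: prob_measure_Rplus_def Rplus_prob_def Rplus_prob_axioms_def)

lemma prob_measure_Rplus_distr:
  assumes "prob_space M" "f \<in> borel_measurable M" "\<And>x. x \<in> space M \<Longrightarrow> f x \<ge> 0"
  shows "prob_measure_Rplus (distr M borel_Rplus f)"
    and "f \<in> measurable M borel_Rplus"
proof -
  show f: "f \<in> measurable M borel_Rplus"
    using assms by (intro measurable_restrict_space2) auto
  then show "prob_measure_Rplus (distr M borel_Rplus f)"
    using prob_space.prob_space_distr[OF assms(1)] by (simp add: prob_measure_Rplus_def)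
qed

text \<open>The integrand \<open>1 / (1 - z t)\<close> in the coordinate \<open>s = 1 / (1 + t)\<close>, extended to all real \<open>s\<close> by clamping.\<close>
definition compact_resolvent :: "complex \<Rightarrow> real \<Rightarrow> complex" where
  "compact_resolvent z s =
    (let c = max 0 (min 1 s) in complex_of_real c / (complex_of_real c - z * complex_of_real (1 - c)))"

lemma compact_resolvent_denominator:
  assumes "c \<noteq> 0"
  shows "complex_of_real c - z * complex_of_real (1 - c) = complex_of_real c * (1 - z * complex_of_real ((1 - c) / c))"
  using assms by (simp add: field_simps)

lemma compact_resolvent_eq:
  assumes "z \<notin> \<real>\<^sub>\<ge>\<^sub>0" "s > 0"
  shows "compact_resolvent z s = 1 / (1 - z * complex_of_real (max 0 (1 / s - 1)))"
proof (cases "s \<ge> 1")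
  case True
  then have "max 0 (1 / s - 1) = 0" "max 0 (min 1 s) = 1" by (auto simp: field_simps)
  then show ?thesis by (simp add: compact_resolvent_def)
next
  case False
  then have e: "max 0 (1 / s - 1) = (1 - s) / s" "max 0 (min 1 s) = s" using assms by (auto simp: field_simps)
  show ?thesis unfolding compact_resolvent_def e Let_def
    using assms(2) by (subst compact_resolvent_denominator) auto
qed

text \<open>The point s = 0 stands for t = \<infinity>. The kernel vanishes there, so mass that
  escapes to infinity is invisible to resolvent values and must be excluded separately.\<close>

lemma compact_resolvent_nonpos: "s \<le> 0 \<Longrightarrow> compact_resolvent z s = 0"
  by (simp add: compact_resolvent_def)

text \<open>At c = 0 the denominator is -z, still nonzero, so continuity extends to t = \<infinity>;
  this is what the compact coordinate is for.\<close>

lemma compact_resolvent_cont: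
  assumes "z \<notin> \<real>\<^sub>\<ge>\<^sub>0"
  shows "isCont (compact_resolvent z) s"
proof -
  have nz: "complex_of_real c - z * complex_of_real (1 - c) \<noteq> 0" if "0 \<le> c" "c \<le> 1" for c
  proof (cases "c = 0")
    case True
    then show ?thesis using slit_nonzero[OF assms] by simp
  next
    case False
    then show ?thesis
      unfolding compact_resolvent_denominator[OF False]
      using resolvent_nonzero[OF assms, of "(1 - c) / c"] that by simp
  qed
  have "complex_of_real (max 0 (min 1 s)) - z * complex_of_real (1 - max 0 (min 1 s)) \<noteq> 0"
    by (rule nz) auto
  then show ?thesis unfolding compact_resolvent_def Let_def
    by (intro continuous_intros)
qed

lemma compact_resolvent_bound:
  assumes "z \<notin> \<real>\<^sub>\<ge>\<^sub>0"
  shows "norm (compact_resolvent z s) \<le> slit_bound z"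
proof (cases "s > 0")
  case True
  then show ?thesis
    unfolding compact_resolvent_eq[OF assms True] by (intro norm_resolvent_le assms) simp
next
  case False
  then show ?thesis using infdist_slit_pos[OF assms]
    by (simp add: compact_resolvent_nonpos slit_bound_def add_nonneg_nonneg)
qed

text \<open>The pushforward under s = 1/(1 + t) lives on (0, 1]. The larger interval
  \<open>{-1<..1}\<close> gives tightness in the half-open form used for weak compactness, with
  slack at the left end.\<close>

lemma finite_resolvent_distribution:
  assumes "finite V" "\<forall>t\<in>V. 0 \<le> t \<and> 0 \<le> c t" "sum c V = 1"
  shows "\<exists>\<nu>. real_distribution \<nu> \<and> measure \<nu> {-1<..1} = 1 \<and>
    (\<forall>z. z \<notin> \<real>\<^sub>\<ge>\<^sub>0 \<longrightarrow> integral\<^sup>L \<nu> (compact_resolvent z) =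
      (\<Sum>t\<in>V. complex_of_real (c t) / (1 - z * complex_of_real t)))"
proof -
  define P where "P = point_measure V c"
  define \<nu> where "\<nu> = distr P borel (\<lambda>t. 1 / (1 + t))"
  interpret P: prob_space P
    unfolding P_def using assms by (intro prob_space_point_measure) auto
  have meas: "(\<lambda>t. 1 / (1 + t)) \<in> measurable P (borel :: real measure)" by (simp add: P_def)
  have "prob_space \<nu>" unfolding \<nu>_def by (rule P.prob_space_distr[OF meas])
  then have "real_distribution \<nu>"
    by (simp add: real_distribution_def real_distribution_axioms_def \<nu>_def)
  moreover have "measure \<nu> {-1<..1} = 1"
  proof -
    have "(\<lambda>t. 1 / (1 + t)) -` {-1<..1} \<inter> space P = space P"
      using assms(2) by (auto simp: P_def space_point_measure field_simps add_pos_nonneg)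
    then show ?thesis unfolding \<nu>_def by (simp add: measure_distr[OF meas] P.prob_space)
  qed
  moreover have "integral\<^sup>L \<nu> (compact_resolvent z) = (\<Sum>t\<in>V. complex_of_real (c t) / (1 - z * complex_of_real t))"
    if z: "z \<notin> \<real>\<^sub>\<ge>\<^sub>0" for z
  proof -
    have "compact_resolvent z \<in> borel_measurable borel"
      using compact_resolvent_cont[OF z] by (intro borel_measurable_continuous_onI continuous_at_imp_continuous_on) auto
    then have "integral\<^sup>L \<nu> (compact_resolvent z) = (\<integral>t. compact_resolvent z (1 / (1 + t)) \<partial>P)"
      unfolding \<nu>_def by (rule integral_distr[OF meas])
    also have "\<dots> = (\<Sum>t\<in>V. c t *\<^sub>R compact_resolvent z (1 / (1 + t)))"
      unfolding P_def using assms by (intro lebesgue_integral_point_measure_finite) auto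
    also have "\<dots> = (\<Sum>t\<in>V. complex_of_real (c t) / (1 - z * complex_of_real t))"
    proof (rule sum.cong[OF refl])
      fix t assume "t \<in> V"
      then have t: "t \<ge> 0" using assms by auto
      then have "max 0 (1 / (1 / (1 + t)) - 1) = t" by simp
      then show "c t *\<^sub>R compact_resolvent z (1 / (1 + t)) = complex_of_real (c t) / (1 - z * complex_of_real t)"
        using t by (subst compact_resolvent_eq[OF z]) (auto simp: scaleR_conv_of_real add_pos_nonneg)
    qed
    finally show ?thesis .
  qed
  ultimately show ?thesis by blast
qed

text \<open>All laws of s live on one bounded interval, hence are tight. A subsequence converges
  weakly, the bounded continuous kernels pass to the limit, and the limit law is carried back to t
  once it is known not to charge s \<le> 0.\<close>

theorem resolvent_mean_limit:
  assumes fin: "\<And>n. \<exists>V c. finite V \<and> (\<forall>t\<in>V. 0 \<le> t \<and> 0 \<le> c t) \<and> sum c V = 1 \<and>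
      (\<forall>z. z \<notin> \<real>\<^sub>\<ge>\<^sub>0 \<longrightarrow> \<Phi> n z = (\<Sum>t\<in>V. complex_of_real (c t) / (1 - z * complex_of_real t)))"
    and conv: "\<And>z. z \<notin> \<real>\<^sub>\<ge>\<^sub>0 \<Longrightarrow> (\<lambda>n. \<Phi> n z) \<longlonglongrightarrow> \<Psi> z"
    and lim: "(\<lambda>n. \<Psi> (- inv_Suc n)) \<longlonglongrightarrow> 1"
  shows "\<exists>\<mu>. prob_measure_Rplus \<mu> \<and> (\<forall>z. z \<notin> \<real>\<^sub>\<ge>\<^sub>0 \<longrightarrow> resolvent_mean \<mu> z = \<Psi> z)"
proof -
  have "\<exists>\<nu>. real_distribution \<nu> \<and> measure \<nu> {-1<..1} = 1 \<and>
    (\<forall>z. z \<notin> \<real>\<^sub>\<ge>\<^sub>0 \<longrightarrow> integral\<^sup>L \<nu> (compact_resolvent z) = \<Phi> n z)" for n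
  proof -
    obtain V c where V: "finite V" "\<forall>t\<in>V. 0 \<le> t \<and> 0 \<le> c t" "sum c V = 1"
      "\<And>z. z \<notin> \<real>\<^sub>\<ge>\<^sub>0 \<Longrightarrow> \<Phi> n z = (\<Sum>t\<in>V. complex_of_real (c t) / (1 - z * complex_of_real t))"
      using fin[of n] by metis
    from finite_resolvent_distribution[OF V(1-3)] show ?thesis using V(4) by metis
  qed
  then obtain \<nu> where \<nu>: "\<And>n. real_distribution (\<nu> n)" "\<And>n. measure (\<nu> n) {-1<..1} = 1"
    "\<And>n z. z \<notin> \<real>\<^sub>\<ge>\<^sub>0 \<Longrightarrow> integral\<^sup>L (\<nu> n) (compact_resolvent z) = \<Phi> n z"
    by metis
  have "tight \<nu>"
    unfolding tight_def
  proof (intro conjI allI impI)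
    fix \<epsilon> :: real assume "\<epsilon> > 0"
    then show "\<exists>a b. a < b \<and> (\<forall>n. 1 - \<epsilon> < measure (\<nu> n) {a<..b})"
      using \<nu>(2) by (intro exI[of _ "-1"] exI[of _ 1]) simp
  qed (rule \<nu>(1))
  from tight_imp_convergent_subsubsequence[OF this strict_mono_id]
  obtain \<rho> M where \<rho>: "strict_mono \<rho>" and M: "real_distribution M" and w: "weak_conv_m (\<nu> \<circ> id \<circ> \<rho>) M"
    by blast
  interpret M: real_distribution M by fact
  have int: "integral\<^sup>L M (compact_resolvent z) = \<Psi> z" if z: "z \<notin> \<real>\<^sub>\<ge>\<^sub>0" for z
  proof (rule LIMSEQ_unique)
    show "(\<lambda>n. integral\<^sup>L ((\<nu> \<circ> id \<circ> \<rho>) n) (compact_resolvent z)) \<longlonglongrightarrow> integral\<^sup>L M (compact_resolvent z)"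
      by (rule weak_conv_imp_integral_bdd_continuous_conv[OF _ M w])
         (use \<nu>(1) compact_resolvent_cont[OF z] compact_resolvent_bound[OF z] in auto)
    show "(\<lambda>n. integral\<^sup>L ((\<nu> \<circ> id \<circ> \<rho>) n) (compact_resolvent z)) \<longlonglongrightarrow> \<Psi> z"
      using LIMSEQ_subseq_LIMSEQ[OF conv[OF z] \<rho>] by (simp add: \<nu>(3)[OF z] o_def)
  qed
  have meas [measurable]: "compact_resolvent z \<in> borel_measurable borel" if "z \<notin> \<real>\<^sub>\<ge>\<^sub>0" for z
    using compact_resolvent_cont[OF that] by (intro borel_measurable_continuous_onI continuous_at_imp_continuous_on) auto
  have neg_slit: "- inv_Suc n \<notin> \<real>\<^sub>\<ge>\<^sub>0" for n
    using Re_inv_Suc_pos[of n] by (simp only: slit_iff uminus_complex.sel) simp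

  \<comment> \<open>At -1/(n+1) the kernels tend to the indicator of s > 0. The values
    \<open>\<Psi> (- inv_Suc n)\<close> therefore tend to the mass of s > 0, and their limit 1 shows
    that nothing escaped to t = \<infinity>.\<close>
  have "(\<lambda>n. integral\<^sup>L M (compact_resolvent (- inv_Suc n))) \<longlonglongrightarrow> (\<integral>s. complex_of_real (indicator {0<..} s) \<partial>M)"
  proof (rule integral_dominated_convergence[where w = "\<lambda>_. 1"])
    show "AE s in M. (\<lambda>n. compact_resolvent (- inv_Suc n) s) \<longlonglongrightarrow> complex_of_real (indicator {0<..} s)"
    proof (rule AE_I2)
      fix s :: real
      show "(\<lambda>n. compact_resolvent (- inv_Suc n) s) \<longlonglongrightarrow> complex_of_real (indicator {0<..} s)"
      proof (cases "s > 0")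
        case True
        have "(\<lambda>n. 1 / (1 - (- inv_Suc n) * complex_of_real (max 0 (1 / s - 1)))) \<longlonglongrightarrow>
            1 / (1 - (- 0) * complex_of_real (max 0 (1 / s - 1)))"
          by (intro tendsto_divide tendsto_diff tendsto_mult tendsto_minus tendsto_const inv_Suc_tendsto) auto
        then show ?thesis using True unfolding compact_resolvent_eq[OF neg_slit True] by simp
      next
        case False
        then show ?thesis by (simp add: compact_resolvent_nonpos)
      qed
    qed
    show "AE s in M. norm (compact_resolvent (- inv_Suc n) s) \<le> 1" for n
    proof (rule AE_I2)
      fix s :: real
      show "norm (compact_resolvent (- inv_Suc n) s) \<le> 1"
      proof (cases "s > 0")
        case True
        define x t where "x = 1 / real (Suc n)" and "t = max 0 (1 / s - 1)"
        have "x \<ge> 0" "t \<ge> 0" by (auto simp: x_def t_def)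
        have "compact_resolvent (- inv_Suc n) s = complex_of_real (1 / (1 + x * t))"
          unfolding compact_resolvent_eq[OF neg_slit True] unfolding x_def[symmetric] t_def[symmetric] by simp
        then show ?thesis using \<open>x \<ge> 0\<close> \<open>t \<ge> 0\<close>
          by (simp only: norm_of_real) (simp add: field_simps add_pos_nonneg)
      qed (simp add: compact_resolvent_nonpos)
    qed
  qed (use meas[OF neg_slit] in simp_all)
  then have "(\<lambda>n. \<Psi> (- inv_Suc n)) \<longlonglongrightarrow> complex_of_real (measure M {0<..})"
    unfolding int[OF neg_slit] by simp
  then have "complex_of_real (measure M {0<..}) = 1" using lim by (rule LIMSEQ_unique)
  then have "measure M {0<..} = 1" by (simp only: of_real_eq_1_iff)
  then have pos: "AE s in M. s > 0"
    using M.AE_prob_1[of "{0<..}"] by simp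

  \<comment> \<open>On (0, 1] this inverts s = 1/(1 + t); the maximum keeps every real s mapped into
    the half-line.\<close>
  define T where "T s = max 0 (1 / s - 1)" for s :: real
  have "T \<in> borel_measurable borel" unfolding T_def[abs_def] by measurable
  then have "T \<in> borel_measurable M" by simp
  then have T: "prob_measure_Rplus (distr M borel_Rplus T)" "T \<in> measurable M borel_Rplus"
    by (auto intro!: prob_measure_Rplus_distr M.prob_space_axioms simp: T_def)
  have "resolvent_mean (distr M borel_Rplus T) z = \<Psi> z" if z: "z \<notin> \<real>\<^sub>\<ge>\<^sub>0" for z
  proof -
    have "resolvent_mean (distr M borel_Rplus T) z = (\<integral>s. 1 / (1 - z * complex_of_real (T s)) \<partial>M)"
      unfolding resolvent_mean_def
      by (rule integral_distr[OF T(2) measurable_restrict_space1[OF borel_measurable_resolvent]])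
    also have "\<dots> = integral\<^sup>L M (compact_resolvent z)"
      using pos z by (intro integral_cong_AE) (auto elim!: eventually_mono simp: T_def compact_resolvent_eq)
    also have "\<dots> = \<Psi> z" by (rule int[OF z])
    finally show ?thesis .
  qed
  with T(1) show ?thesis by blast
qed

section \<open>Uniqueness\<close>

context Rplus_prob
begin

text \<open>Moments of r = t/(1 + t), which lies in [0, 1): they exist for every \<mu>, even when
  \<mu> has no finite moments.\<close>

abbreviation compact_moment :: "nat \<Rightarrow> real" where
  "compact_moment k \<equiv> \<integral>t. (t / (1 + t)) ^ k \<partial>\<mu>"

lemma compact_power_bounds: "t \<ge> 0 \<Longrightarrow> 0 \<le> (t / (1 + t)) ^ k \<and> (t / (1 + t)) ^ k \<le> 1" for t :: real
  by (auto intro!: power_le_one)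

lemma compact_moment_integrable: "integrable \<mu> (\<lambda>t. (t / (1 + t)) ^ k)"
proof (rule integrable_const_bound[of _ 1])
  show "AE t in \<mu>. norm ((t / (1 + t)) ^ k) \<le> 1"
    using AE_nonneg by eventually_elim (use compact_power_bounds in auto)
qed simp

text \<open>An expansion about x = 1, with y = 1 - x: 1/(1 + (1 - y) t) = (1 - r)/(1 - y r), a
  geometric series in y r, integrated term by term.\<close>

lemma laplace_mean_power_series:
  assumes "\<bar>y\<bar> < 1"
  shows "(\<lambda>k. (compact_moment k - compact_moment (Suc k)) * y ^ k) sums laplace_mean (1 - y)"
proof -
  define f where "f k t = ((t / (1 + t)) ^ k - (t / (1 + t)) ^ Suc k) * y ^ k" for k and t :: real
  have f_int: "integrable \<mu> (f k)" for k
    unfolding f_def by (intro integrable_mult_left Bochner_Integration.integrable_diff compact_moment_integrable)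
  have f_le: "norm (f k t) \<le> \<bar>y\<bar> ^ k" if "t \<ge> 0" for k t
  proof -
    have "\<bar>(t / (1 + t)) ^ k - (t / (1 + t)) ^ Suc k\<bar> \<le> 1"
      using compact_power_bounds[OF that, of k] compact_power_bounds[OF that, of "Suc k"] by linarith
    then show ?thesis unfolding f_def
      by (simp add: abs_mult power_abs mult_left_le_one_le del: power_Suc)
  qed
  have geo: "summable (\<lambda>k. \<bar>y\<bar> ^ k)" using assms by (intro summable_geometric) simp
  have "(\<lambda>k. integral\<^sup>L \<mu> (f k)) sums (\<integral>t. (\<Sum>k. f k t) \<partial>\<mu>)"
  proof (rule sums_integral[OF f_int])
    show "AE t in \<mu>. summable (\<lambda>k. norm (f k t))"
      using AE_nonneg by eventually_elim (rule summable_comparison_test'[OF geo], use f_le in auto)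
    show "summable (\<lambda>k. \<integral>t. norm (f k t) \<partial>\<mu>)"
    proof (rule summable_comparison_test'[OF geo])
      fix k
      have "(\<integral>t. norm (f k t) \<partial>\<mu>) \<le> (\<integral>t. \<bar>y\<bar> ^ k \<partial>\<mu>)"
        by (intro integral_mono_AE integrable_norm f_int) (use AE_nonneg f_le in \<open>auto elim!: eventually_mono\<close>)
      then show "norm (\<integral>t. norm (f k t) \<partial>\<mu>) \<le> \<bar>y\<bar> ^ k"
        by (simp add: prob_space)
    qed
  qed
  moreover have "(\<integral>t. (\<Sum>k. f k t) \<partial>\<mu>) = laplace_mean (1 - y)"
  proof (rule Bochner_Integration.integral_cong[OF refl])
    fix t assume "t \<in> space \<mu>"
    then have t: "t \<ge> 0" by (simp add: space_Rplus)
    define r where "r = t / (1 + t)"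
    have r: "0 \<le> r" "r < 1" using t by (auto simp: r_def field_simps)
    have "\<bar>y\<bar> * r < 1" using mult_strict_mono'[of "\<bar>y\<bar>" 1 r 1] assms r by simp
    then have yr: "\<bar>y * r\<bar> < 1" using r by (simp add: abs_mult)
    have "f k t = (1 - r) * (y * r) ^ k" for k
      by (simp add: f_def r_def[symmetric] power_mult_distrib algebra_simps)
    then have "(\<Sum>k. f k t) = (1 - r) * (1 / (1 - y * r))"
      using sums_mult[OF geometric_sums[of "y * r"], of "1 - r"] yr by (simp add: sums_iff)
    also have "\<dots> = 1 / (1 + (1 - y) * t)"
    proof -
      have 1: "1 - r = 1 / (1 + t)" "1 - y * r = (1 + (1 - y) * t) / (1 + t)"
        using t by (auto simp: r_def field_simps)
      show ?thesis unfolding 1 using t by simp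
    qed
    finally show "(\<Sum>k. f k t) = 1 / (1 + (1 - y) * t)" .
  qed
  moreover have "integral\<^sup>L \<mu> (f k) = (compact_moment k - compact_moment (Suc k)) * y ^ k" for k
    unfolding f_def using compact_moment_integrable[of k] compact_moment_integrable[of "Suc k"]
    by (simp del: power_Suc)
  ultimately show ?thesis by simp
qed

text \<open>Since r is bounded by 1, the exponential series is dominated by |u|^k / k! and
  integrates term by term; the moments of r thus determine its characteristic function.\<close>

lemma compact_char_sums:
  "(\<lambda>k. (\<i> * complex_of_real u) ^ k / fact k * complex_of_real (compact_moment k)) sums
    char (distr \<mu> borel (\<lambda>t. t / (1 + t))) u"
proof -
  define f where "f k t = (\<i> * complex_of_real u) ^ k / fact k * complex_of_real ((t / (1 + t)) ^ k)" for k and t :: real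
  have f_int: "integrable \<mu> (f k)" for k
    unfolding f_def by (intro integrable_mult_right integrable_of_real compact_moment_integrable)
  have f_le: "norm (f k t) \<le> \<bar>u\<bar> ^ k / fact k" if "t \<ge> 0" for k t
  proof -
    have "norm (f k t) = \<bar>u\<bar> ^ k / fact k * \<bar>(t / (1 + t)) ^ k\<bar>"
      unfolding f_def norm_mult norm_divide norm_power norm_of_real norm_ii norm_fact by simp
    also have "\<dots> \<le> \<bar>u\<bar> ^ k / fact k"
      using compact_power_bounds[OF that, of k] by (intro mult_left_le) auto
    finally show ?thesis .
  qed
  have ex: "summable (\<lambda>k. \<bar>u\<bar> ^ k / fact k)" using summable_exp[of "\<bar>u\<bar>"] by (simp add: field_simps)
  have "(\<lambda>k. integral\<^sup>L \<mu> (f k)) sums (\<integral>t. (\<Sum>k. f k t) \<partial>\<mu>)"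
  proof (rule sums_integral[OF f_int])
    show "AE t in \<mu>. summable (\<lambda>k. norm (f k t))"
      using AE_nonneg by eventually_elim (rule summable_comparison_test'[OF ex], use f_le in auto)
    show "summable (\<lambda>k. \<integral>t. norm (f k t) \<partial>\<mu>)"
    proof (rule summable_comparison_test'[OF ex])
      fix k
      have "(\<integral>t. norm (f k t) \<partial>\<mu>) \<le> (\<integral>t. \<bar>u\<bar> ^ k / fact k \<partial>\<mu>)"
        by (intro integral_mono_AE integrable_norm f_int) (use AE_nonneg f_le in \<open>auto elim!: eventually_mono\<close>)
      then show "norm (\<integral>t. norm (f k t) \<partial>\<mu>) \<le> \<bar>u\<bar> ^ k / fact k"
        by (simp add: prob_space)
    qed
  qed
  moreover have "(\<integral>t. (\<Sum>k. f k t) \<partial>\<mu>) = char (distr \<mu> borel (\<lambda>t. t / (1 + t))) u"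
  proof -
    have "(\<Sum>k. f k t) = iexp (u * (t / (1 + t)))" for t
    proof -
      have "f k t = (\<i> * complex_of_real (u * (t / (1 + t)))) ^ k /\<^sub>R fact k" for k
        unfolding f_def of_real_mult of_real_power mult.assoc[symmetric] power_mult_distrib[of _ "complex_of_real (t / (1 + t))"]
        by (simp add: scaleR_conv_of_real field_simps)
      then show ?thesis by (simp only: exp_def)
    qed
    moreover have "(\<lambda>t. t / (1 + t)) \<in> borel_measurable \<mu>" by measurable
    ultimately show ?thesis unfolding char_def by (subst integral_distr) auto
  qed
  moreover have "integral\<^sup>L \<mu> (f k) = (\<i> * complex_of_real u) ^ k / fact k * complex_of_real (compact_moment k)" for k
    unfolding f_def by (simp del: of_real_power of_real_divide)
  ultimately show ?thesis by simp
qed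

lemma distr_compact_inverse:
  "distr (distr \<mu> borel (\<lambda>t. t / (1 + t))) borel_Rplus (\<lambda>x. max 0 (x / (1 - x))) = \<mu>"
proof -
  have m: "(\<lambda>x::real. max 0 (x / (1 - x))) \<in> measurable borel borel_Rplus"
    by (intro measurable_restrict_space2) auto
  have "(\<lambda>t. t / (1 + t)) \<in> borel_measurable \<mu>" by measurable
  then have "distr (distr \<mu> borel (\<lambda>t. t / (1 + t))) borel_Rplus (\<lambda>x. max 0 (x / (1 - x))) =
      distr \<mu> borel_Rplus ((\<lambda>x. max 0 (x / (1 - x))) \<circ> (\<lambda>t. t / (1 + t)))"
    by (rule distr_distr[OF m])
  also have "\<dots> = distr \<mu> \<mu> (\<lambda>t. t)"
  proof (rule distr_cong)
    fix t assume "t \<in> space \<mu>"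
    then have t: "t \<ge> 0" by (simp add: space_Rplus)
    then have "1 - t / (1 + t) = 1 / (1 + t)" by (simp add: field_simps)
    then show "((\<lambda>x. max 0 (x / (1 - x))) \<circ> (\<lambda>t. t / (1 + t))) t = t" using t by simp
  qed (simp_all add: sets_Rplus)
  also have "\<dots> = \<mu>" by (rule distr_id)
  finally show ?thesis .
qed

end

text \<open>Values on the negative axis suffice: they determine the differences of consecutive
  moments of r, and the zeroth moment is 1, so all moments agree. Levy uniqueness identifies the
  laws of r, and r determines t.\<close>

theorem resolvent_mean_unique:
  assumes "Rplus_prob M" "Rplus_prob N"
    and eq: "\<And>x. x > 0 \<Longrightarrow> resolvent_mean M (- complex_of_real x) = resolvent_mean N (- complex_of_real x)"
  shows "M = N"
proof -
  interpret M: Rplus_prob M by fact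
  interpret N: Rplus_prob N by fact
  define a where "a k = (M.compact_moment k - M.compact_moment (Suc k)) - (N.compact_moment k - N.compact_moment (Suc k))" for k
  have a_sums: "(\<lambda>k. a k * (y - 0) ^ k) sums 0" if "norm (y - 0) < 1" for y
  proof -
    have "M.laplace_mean (1 - y) = N.laplace_mean (1 - y)"
      using eq[of "1 - y"] that unfolding M.resolvent_mean_neg N.resolvent_mean_neg of_real_eq_iff by simp
    then show ?thesis
      using sums_diff[OF M.laplace_mean_power_series[of y] N.laplace_mean_power_series[of y]] that
      by (simp add: a_def left_diff_distrib del: power_Suc)
  qed
  \<comment> \<open>The constant coefficient is read off at y = 0. For positive k, a nonzero
    coefficient would make the zero at 0 isolated, while the sum vanishes on the whole disc.\<close>
  have a0: "a k = 0" for k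
  proof (cases "k = 0")
    case True
    have "(\<lambda>k. a k * 0 ^ k) sums 0" using a_sums[of 0] by (simp only: diff_self norm_zero zero_less_one)
    then have "a 0 = 0" using powser_sums_zero[of a] sums_unique2 by blast
    then show ?thesis using True by simp
  next
    case False
    show ?thesis
    proof (rule ccontr)
      assume "a k \<noteq> 0"
      show False
      proof (rule powser_0_nonzero[of 1 0 a "\<lambda>_. 0" k])
        fix s :: real
        assume "0 < s" "\<And>z::real. z \<in> cball 0 s - {0} \<Longrightarrow> (0::real) \<noteq> 0"
        from this(2)[of s] this(1) show False by simp
      qed (use a_sums False \<open>a k \<noteq> 0\<close> in auto)
    qed
  qed
  have moments: "M.compact_moment k = N.compact_moment k" for k
  proof (induction k)
    case 0
    show ?case by (simp add: M.prob_space N.prob_space)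
  next
    case (Suc k)
    then show ?case using a0[of k] by (simp add: a_def del: power_Suc)
  qed
  have rd: "real_distribution (distr P borel (\<lambda>t. t / (1 + t)))" if "Rplus_prob P" for P
  proof -
    interpret P: Rplus_prob P by fact
    have "(\<lambda>t. t / (1 + t)) \<in> borel_measurable P" by measurable
    from P.prob_space_distr[OF this] show ?thesis
      by (simp add: real_distribution_def real_distribution_axioms_def)
  qed
  have "char (distr M borel (\<lambda>t. t / (1 + t))) u = char (distr N borel (\<lambda>t. t / (1 + t))) u" for u
    using M.compact_char_sums[of u] N.compact_char_sums[of u] unfolding moments by (rule sums_unique2)
  then have "distr M borel (\<lambda>t. t / (1 + t)) = distr N borel (\<lambda>t. t / (1 + t))"
    by (intro Levy_uniqueness rd assms) auto
  then show ?thesis using M.distr_compact_inverse N.distr_compact_inverse by metis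
qed

section \<open>The orthogonal convolution\<close>

definition orth_eta :: "real measure \<Rightarrow> real measure \<Rightarrow> complex \<Rightarrow> complex" where
  "orth_eta M1 M2 z = z * eta M1 (eta M2 z) / eta M2 z"

text \<open>The candidate for the resolvent mean of the convolution, obtained by solving eta = 1 -
  1/A for A.\<close>

definition orth_mean :: "real measure \<Rightarrow> real measure \<Rightarrow> complex \<Rightarrow> complex" where
  "orth_mean M1 M2 z = 1 / (1 - orth_eta M1 M2 z)"

locale Rplus_prob_pair = M1: Rplus_prob M1 + M2: Rplus_prob M2 for M1 M2 :: "real measure" +
  assumes nontrivial: "\<not> (AE t in M2. t = 0)"
begin

lemma orth_eta_cnj: "orth_eta M1 M2 (cnj z) = cnj (orth_eta M1 M2 z)"
  by (simp add: orth_eta_def M1.eta_cnj M2.eta_cnj)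

text \<open>On the negative axis everything is real: the inner eta sends -x to -y and the outer one
  sends -y to -v. The bound on y combines 1/a - 1 \<ge> 1 - a with
  \<open>one_minus_laplace_mean\<close>.\<close>

lemma orth_eta_neg:
  assumes "x > 0"
  defines "y \<equiv> 1 / M2.laplace_mean x - 1"
  defines "v \<equiv> 1 / M1.laplace_mean y - 1"
  shows "y > 0" "v \<ge> 0" "orth_eta M1 M2 (- complex_of_real x) = - complex_of_real (x * v / y)"
    "x \<le> 1 \<Longrightarrow> y \<ge> x * (1 - M2.laplace_mean 1)"
proof -
  show y: "y > 0"
    using M2.laplace_mean_pos[of x] M2.laplace_mean_less_1[of x] assms nontrivial
    by (simp add: field_simps)
  then show "v \<ge> 0"
    using M1.laplace_mean_pos[of y] M1.laplace_mean_le_1[of y] unfolding v_def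
    by (simp add: field_simps)
  show "orth_eta M1 M2 (- complex_of_real x) = - complex_of_real (x * v / y)"
    unfolding orth_eta_def M2.eta_neg[OF assms(1)] y_def[symmetric] M1.eta_neg[OF y] v_def[symmetric]
    by simp
  assume "x \<le> 1"
  have "x * (1 - M2.laplace_mean 1) \<le> 1 - M2.laplace_mean x"
    by (rule M2.one_minus_laplace_mean) fact+
  also have "\<dots> \<le> y"
  proof -
    have "a > 0 \<Longrightarrow> 1 - a \<le> 1 / a - 1" for a :: real
      using zero_le_power2[of "a - 1"] by (simp add: field_simps power2_eq_square)
    then show ?thesis using M2.laplace_mean_pos[of x] assms(1) unfolding y_def by simp
  qed
  finally show "y \<ge> x * (1 - M2.laplace_mean 1)" .
qed

text \<open>The modulus is (x/y) v. The factor x/y is at most 1/c with c =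
  \<open>1 - M2.laplace_mean 1\<close> > 0, while y and then v tend to 0.\<close>

lemma orth_eta_tendsto_0: "(\<lambda>n. orth_eta M1 M2 (- complex_of_real (1 / Suc n))) \<longlonglongrightarrow> 0"
proof -
  define x where "x n = 1 / real (Suc n)" for n
  define y where "y n = 1 / M2.laplace_mean (x n) - 1" for n
  define v where "v n = 1 / M1.laplace_mean (y n) - 1" for n
  define c where "c = 1 - M2.laplace_mean 1"
  have x: "x n > 0" "x n \<le> 1" for n by (auto simp: x_def)
  have c: "c > 0" using M2.laplace_mean_less_1[of 1] nontrivial by (simp add: c_def)
  note * = orth_eta_neg(1-3)[OF x(1), folded y_def, folded v_def] orth_eta_neg(4)[OF x, folded y_def c_def]
  have "x \<longlonglongrightarrow> 0" unfolding x_def by (rule LIMSEQ_inverse_real_of_nat[unfolded inverse_eq_divide])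
  then have "(\<lambda>n. M2.laplace_mean (x n)) \<longlonglongrightarrow> 1"
    by (intro M2.laplace_mean_tendsto x)
  then have "y \<longlonglongrightarrow> 1 / 1 - 1"
    unfolding y_def by (intro tendsto_intros) auto
  then have "(\<lambda>n. M1.laplace_mean (y n)) \<longlonglongrightarrow> 1"
    by (intro M1.laplace_mean_tendsto *) auto
  then have "v \<longlonglongrightarrow> 1 / 1 - 1"
    unfolding v_def by (intro tendsto_intros) auto
  then have "(\<lambda>n. v n / c) \<longlonglongrightarrow> 0"
    using tendsto_divide_zero[of v sequentially c] by simp
  moreover have "norm (orth_eta M1 M2 (- complex_of_real (x n))) \<le> v n / c" for n
  proof -
    have "x n * v n * c \<le> v n * y n"
      using mult_left_mono[OF *(4)[of n] *(2)[of n]] by (simp add: mult_ac)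
    then have "x n * v n / y n \<le> v n / c"
      using c *(1)[of n] by (simp add: field_simps)
    moreover have "norm (orth_eta M1 M2 (- complex_of_real (x n))) = x n * v n / y n"
      unfolding *(3) norm_minus_cancel norm_of_real using *(1,2)[of n] x[of n] by simp
    ultimately show ?thesis by simp
  qed
  ultimately have "(\<lambda>n. orth_eta M1 M2 (- complex_of_real (x n))) \<longlonglongrightarrow> 0"
    by (rule Lim_null_comparison[OF always_eventually[OF allI], rotated])
  then show ?thesis unfolding x_def .
qed

lemma orth_mean_tendsto_1: "(\<lambda>n. orth_mean M1 M2 (- complex_of_real (1 / Suc n))) \<longlonglongrightarrow> 1"
proof -
  have "(\<lambda>n. orth_mean M1 M2 (- complex_of_real (1 / Suc n))) \<longlonglongrightarrow> 1 / (1 - 0)"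
    unfolding orth_mean_def by (intro tendsto_intros orth_eta_tendsto_0) auto
  then show ?thesis by simp
qed

text \<open>With u the inner eta and k = \<open>eta M1 u / u\<close>, the function is z k. Both k
  and u k have nonnegative imaginary part, and Im u * z = Im (u * cnj z) + Im z * u with nonnegative
  coefficients.\<close>

lemma orth_eta_upper:
  assumes "Im z > 0"
  shows "Im (orth_eta M1 M2 z) \<ge> 0" "Im (orth_eta M1 M2 z / z) \<ge> 0"
proof -
  define u where "u = eta M2 z"
  define k where "k = eta M1 u / u"
  have u: "Im u > 0" unfolding u_def by (rule M2.Im_eta_pos[OF assms nontrivial])
  have k: "Im k \<ge> 0" unfolding k_def by (rule M1.Im_eta_over_nonneg[OF u])
  have "eta M1 u = u * k" using u by (auto simp: k_def)
  then have uk: "Im (u * k) \<ge> 0" using M1.Im_eta_nonneg[OF u] by simp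
  have "Im (u / z) \<ge> 0" unfolding u_def by (rule M2.Im_eta_over_nonneg[OF assms])
  moreover have "u / z = u * cnj z / complex_of_real ((cmod z)\<^sup>2)"
    using complex_div_cnj by blast
  ultimately have "0 \<le> Im (u * cnj z) / (cmod z)\<^sup>2"
    by (metis Im_divide_of_real)
  moreover have "z \<noteq> 0" using assms by auto
  ultimately have uz: "Im (u * cnj z) \<ge> 0"
    by (simp only: zero_le_divide_iff) simp
  have e: "orth_eta M1 M2 z = z * k" by (simp add: orth_eta_def u_def k_def)
  \<comment> \<open>\<open>z\<close> lies in the cone spanned by \<open>1\<close> and \<open>u\<close>, and both \<open>k\<close> and \<open>u * k\<close> lie in the closed upper half-plane.\<close>
  have "Im u * Im (z * k) = Im (u * cnj z) * Im k + Im z * Im (u * k)"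
    by (simp add: algebra_simps)
  also have "\<dots> \<ge> 0" using uz k uk assms by simp
  finally show "Im (orth_eta M1 M2 z) \<ge> 0"
    using u by (simp add: e zero_le_mult_iff)
  show "Im (orth_eta M1 M2 z / z) \<ge> 0"
    unfolding e using \<open>z \<noteq> 0\<close> k by (simp only: nonzero_mult_div_cancel_left not_False_eq_True)
qed

text \<open>A value 1 at w in the upper half-plane would give \<open>orth_eta M1 M2 w / w\<close> =
  1/w, whose imaginary part is negative. On the negative axis the values are \<le> 0.\<close>

lemma one_minus_orth_eta:
  assumes "z \<notin> \<real>\<^sub>\<ge>\<^sub>0"
  shows "1 - orth_eta M1 M2 z \<noteq> 0"
proof -
  have *: "orth_eta M1 M2 w \<noteq> 1" if "Im w > 0" for w
  proof
    assume "orth_eta M1 M2 w = 1"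
    then have "Im (1 / w) \<ge> 0" using orth_eta_upper(2)[OF that] by simp
    moreover have "Im (1 / w) < 0"
      using that by (simp add: Im_divide divide_pos_pos sum_power2_gt_zero_iff)
    ultimately show False by simp
  qed
  from assms show ?thesis
  proof (cases z rule: slit_cases)
    case (3 x)
    define y where "y = 1 / M2.laplace_mean x - 1"
    define v where "v = 1 / M1.laplace_mean y - 1"
    note * = orth_eta_neg(1-3)[OF 3(2), folded y_def, folded v_def]
    have "1 - orth_eta M1 M2 z = complex_of_real (1 + x * v / y)"
      using 3(1) *(3) by simp
    moreover have "x * v / y \<ge> 0" using *(1,2) 3(2) by simp
    then have "1 + x * v / y \<noteq> 0" by linarith
    ultimately show ?thesis by (simp only: of_real_eq_0_iff not_False_eq_True)
  qed (use *[of z] *[of "cnj z"] orth_eta_cnj[of z] in auto)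
qed

text \<open>Multiplied by z, the function becomes 1 / (1/z - \<open>orth_eta M1 M2 z / z\<close>),
  the reciprocal of a number in the closed lower half-plane.\<close>

lemma orth_mean_upper:
  assumes "Im z > 0"
  shows "Im (orth_mean M1 M2 z) \<ge> 0" "Im (z * orth_mean M1 M2 z) \<ge> 0"
proof -
  show "Im (orth_mean M1 M2 z) \<ge> 0"
    using orth_eta_upper(1)[OF assms] by (simp add: orth_mean_def Im_divide)
  have z: "z \<notin> \<real>\<^sub>\<ge>\<^sub>0" "z \<noteq> 0" using assms by (auto simp: slit_iff)
  have "z * orth_mean M1 M2 z = 1 / (1 / z - orth_eta M1 M2 z / z)"
    using one_minus_orth_eta[OF z(1)] z(2) by (simp add: orth_mean_def field_simps)
  moreover have "Im (1 / z) \<le> 0" using assms by (simp add: Im_divide)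
  then have "Im (1 / z - orth_eta M1 M2 z / z) \<le> 0"
    using orth_eta_upper(2)[OF assms] by simp
  moreover have "Im w \<le> 0 \<Longrightarrow> Im (1 / w) \<ge> 0" for w by (simp add: Im_divide divide_nonpos_nonneg)
  ultimately show "Im (z * orth_mean M1 M2 z) \<ge> 0" by (simp only:)
qed

end

section \<open>Discretisation of the two measures\<close>

text \<open>Rounding up, so that a positive \<open>t\<close> stays positive and a measure other than the point mass at \<open>0\<close> is not discretised to it.\<close>
definition ceil_approx :: "nat \<Rightarrow> real \<Rightarrow> real" where
  "ceil_approx n t = min (real_of_int \<lceil>real (Suc n) * t\<rceil> / real (Suc n)) (real (Suc n))"

lemma ceil_approx_measurable [measurable]: "ceil_approx n \<in> borel_measurable borel"
  unfolding ceil_approx_def[abs_def] by measurable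

lemma ceil_approx_nonneg: "t \<ge> 0 \<Longrightarrow> ceil_approx n t \<ge> 0"
  by (auto simp: ceil_approx_def min_def intro!: divide_nonneg_nonneg)
    (smt (verit) mult_nonneg_nonneg of_nat_0_le_iff ceiling_mono ceiling_zero of_int_0_le_iff)

lemma ceil_approx_pos: 
  assumes "t > 0"
  shows "ceil_approx n t > 0"
proof -
  have "0 < real (Suc n) * t" using assms by simp
  then have "0 < \<lceil>real (Suc n) * t\<rceil>" by (simp only: zero_less_ceiling)
  then show ?thesis by (simp add: ceil_approx_def del: of_nat_Suc)
qed

text \<open>Once n + 1 \<ge> t, the cap does not push the value below t, so it lies between t and t
  + 1/(n+1).\<close>

lemma ceil_approx_tendsto: "(\<lambda>n. ceil_approx n t) \<longlonglongrightarrow> t"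
proof (rule tendsto_sandwich)
  show "\<forall>\<^sub>F n in sequentially. t \<le> ceil_approx n t"
  proof (rule eventually_sequentiallyI)
    fix n assume "nat \<lceil>t\<rceil> \<le> n"
    then have "t \<le> real (Suc n)" by linarith
    moreover have "real (Suc n) * t \<le> real_of_int \<lceil>real (Suc n) * t\<rceil>" by (rule le_of_int_ceiling)
    then have "t \<le> real_of_int \<lceil>real (Suc n) * t\<rceil> / real (Suc n)"
      by (simp only: pos_le_divide_eq of_nat_0_less_iff zero_less_Suc mult.commute)
    ultimately show "t \<le> ceil_approx n t" by (simp add: ceil_approx_def)
  qed
  show "\<forall>\<^sub>F n in sequentially. ceil_approx n t \<le> t + 1 / real (Suc n)"
  proof (rule always_eventually, rule allI)
    fix n
    have "real_of_int \<lceil>real (Suc n) * t\<rceil> \<le> real (Suc n) * t + 1" by (rule of_int_ceiling_le_add_one)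
    then have "real_of_int \<lceil>real (Suc n) * t\<rceil> / real (Suc n) \<le> (real (Suc n) * t + 1) / real (Suc n)"
      by (intro divide_right_mono) auto
    also have "\<dots> = t + 1 / real (Suc n)" by (simp add: add_divide_distrib del: of_nat_Suc)
    finally show "ceil_approx n t \<le> t + 1 / real (Suc n)" by (simp add: ceil_approx_def)
  qed
  show "(\<lambda>n. t + 1 / real (Suc n)) \<longlonglongrightarrow> t"
    using tendsto_add[OF tendsto_const[of t] LIMSEQ_inverse_real_of_nat] by (simp add: inverse_eq_divide)
qed simp

text \<open>The cap at n + 1 leaves only the grid points k/(n+1) with 0 \<le> k \<le>
  (n+1)^2.\<close>

lemma ceil_approx_finite: "finite (ceil_approx n ` {0..})"
proof (rule finite_subset)
  let ?N = "real (Suc n)"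
  show "ceil_approx n ` {0..} \<subseteq> insert ?N ((\<lambda>k. real_of_int k / ?N) ` {0..int (Suc n) * int (Suc n)})"
  proof
    fix v assume "v \<in> ceil_approx n ` {0..}"
    then obtain t where t: "t \<ge> 0" "v = ceil_approx n t" by auto
    define k where "k = \<lceil>?N * t\<rceil>"
    have k0: "k \<ge> 0"
      using t by (simp add: k_def) (smt (verit) mult_nonneg_nonneg of_nat_0_le_iff)
    show "v \<in> insert ?N ((\<lambda>k. real_of_int k / ?N) ` {0..int (Suc n) * int (Suc n)})"
    proof (cases "real_of_int k / ?N \<le> ?N")
      case True
      then have "real_of_int k \<le> ?N * ?N" by (simp only: pos_divide_le_eq of_nat_0_less_iff zero_less_Suc)
      then have "real_of_int k \<le> real_of_int (int (Suc n) * int (Suc n))" by (simp only: of_int_mult of_int_of_nat_eq)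
      then have "k \<le> int (Suc n) * int (Suc n)" by (simp only: of_int_le_iff)
      moreover have "v = real_of_int k / ?N" using True t by (simp add: ceil_approx_def k_def del: of_nat_Suc)
      ultimately show ?thesis using k0 by (simp del: of_nat_Suc)
    next
      case False
      then show ?thesis using t by (simp add: ceil_approx_def k_def del: of_nat_Suc)
    qed
  qed
qed auto

definition ceil_distr :: "real measure \<Rightarrow> nat \<Rightarrow> real measure" where
  "ceil_distr \<mu> n = distr \<mu> borel_Rplus (ceil_approx n)"

context Rplus_prob
begin

lemma ceil_distr_Rplus: "Rplus_prob (ceil_distr \<mu> n)"
  and ceil_approx_Rplus: "ceil_approx n \<in> measurable \<mu> borel_Rplus"
proof -
  have "ceil_approx n \<in> borel_measurable \<mu>" by (rule measurable_Rplus) simp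
  then show "Rplus_prob (ceil_distr \<mu> n)" "ceil_approx n \<in> measurable \<mu> borel_Rplus"
    unfolding ceil_distr_def
    by (auto intro!: prob_measure_RplusD prob_measure_Rplus_distr prob_space_axioms ceil_approx_nonneg simp: space_Rplus)
qed

lemma resolvent_mean_ceil_distr:
  "resolvent_mean (ceil_distr \<mu> n) z = (\<integral>t. 1 / (1 - z * complex_of_real (ceil_approx n t)) \<partial>\<mu>)"
  unfolding resolvent_mean_def ceil_distr_def
  by (rule integral_distr[OF ceil_approx_Rplus measurable_restrict_space1[OF borel_measurable_resolvent]])

lemma ceil_distr_nontrivial:
  assumes "\<not> (AE t in \<mu>. t = 0)"
  shows "\<not> (AE t in ceil_distr \<mu> n. t = 0)"
proof
  assume "AE t in ceil_distr \<mu> n. t = 0"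
  then have "AE t in \<mu>. ceil_approx n t = 0"
    unfolding ceil_distr_def by (rule AE_distrD[OF ceil_approx_Rplus])
  with AE_nonneg have "AE t in \<mu>. t = 0"
    by eventually_elim (metis ceil_approx_pos less_eq_real_def less_irrefl)
  with assms show False by simp
qed

lemma resolvent_mean_ceil_distr_tendsto:
  assumes "z \<notin> \<real>\<^sub>\<ge>\<^sub>0" "Z \<longlonglongrightarrow> z"
  shows "(\<lambda>n. resolvent_mean (ceil_distr \<mu> n) (Z n)) \<longlonglongrightarrow> resolvent_mean \<mu> z"
  unfolding resolvent_mean_ceil_distr
  by (rule resolvent_mean_tendsto[OF assms])
     (auto intro: ceil_approx_nonneg ceil_approx_tendsto)

lemma eta_ceil_distr_tendsto:
  assumes "z \<notin> \<real>\<^sub>\<ge>\<^sub>0" "Z \<longlonglongrightarrow> z" "\<And>n. Z n \<notin> \<real>\<^sub>\<ge>\<^sub>0"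
  shows "(\<lambda>n. eta (ceil_distr \<mu> n) (Z n)) \<longlonglongrightarrow> eta \<mu> z"
proof -
  have "(\<lambda>n. 1 - 1 / resolvent_mean (ceil_distr \<mu> n) (Z n)) \<longlonglongrightarrow> 1 - 1 / resolvent_mean \<mu> z"
    by (intro tendsto_intros resolvent_mean_ceil_distr_tendsto assms resolvent_mean_nonzero)
  then show ?thesis
    using Rplus_prob.eta_eq[OF ceil_distr_Rplus assms(3)] eta_eq[OF assms(1)] by simp
qed

text \<open>The weights are the measures of the level sets of \<open>ceil_approx n\<close>. The
  coefficients are stated as arbitrary complex numbers because the formula only serves to show
  rationality.\<close>

lemma resolvent_mean_ceil_distr_finite:
  "\<exists>V c. finite V \<and> V \<subseteq> {0..} \<and>
    (\<forall>z. resolvent_mean (ceil_distr \<mu> n) z = (\<Sum>v\<in>V. c v / (1 - z * complex_of_real v)))"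
proof (intro exI conjI allI)
  define V where "V = ceil_approx n ` {0..}"
  define A where "A v = ceil_approx n -` {v} \<inter> space \<mu>" for v
  have fin: "finite V" unfolding V_def by (rule ceil_approx_finite)
  show "finite V" by fact
  show "V \<subseteq> {0..}" using ceil_approx_nonneg by (auto simp: V_def)
  have "ceil_approx n \<in> borel_measurable \<mu>" by (rule measurable_Rplus) simp
  then have A: "A v \<in> sets \<mu>" for v unfolding A_def by (rule measurable_sets) simp
  fix z :: complex
  have "resolvent_mean (ceil_distr \<mu> n) z =
      (\<integral>t. (\<Sum>v\<in>V. indicator (A v) t *\<^sub>R (1 / (1 - z * complex_of_real v))) \<partial>\<mu>)"
    unfolding resolvent_mean_ceil_distr
  proof (rule Bochner_Integration.integral_cong[OF refl])
    fix t assume t: "t \<in> space \<mu>"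
    then have "ceil_approx n t \<in> V" by (auto simp: V_def space_Rplus)
    then have "(\<Sum>v\<in>V. indicator (A v) t *\<^sub>R (1 / (1 - z * complex_of_real v))) =
        (\<Sum>v\<in>V. if v = ceil_approx n t then 1 / (1 - z * complex_of_real v) else 0)"
      using t by (intro sum.cong) (auto simp: A_def indicator_def)
    then show "1 / (1 - z * complex_of_real (ceil_approx n t)) =
        (\<Sum>v\<in>V. indicator (A v) t *\<^sub>R (1 / (1 - z * complex_of_real v)))"
      using fin \<open>ceil_approx n t \<in> V\<close> by simp
  qed
  also have "\<dots> = (\<Sum>v\<in>V. measure \<mu> (A v) *\<^sub>R (1 / (1 - z * complex_of_real v)))"
    using A by (subst Bochner_Integration.integral_sum) (auto simp: emeasure_eq_measure intro!: integrable_scaleR_left integrable_real_indicator)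
  finally show "resolvent_mean (ceil_distr \<mu> n) z =
      (\<Sum>v\<in>V. complex_of_real (measure \<mu> (A v)) / (1 - z * complex_of_real v))"
    by (simp add: scaleR_conv_of_real)
qed

text \<open>The inner function u covers two uses: the identity for the inner measure, and the inner
  eta for the composition.\<close>

lemma slit_rational_eta_ceil_distr:
  assumes "slit_rational u" "\<And>z. z \<notin> \<real>\<^sub>\<ge>\<^sub>0 \<Longrightarrow> u z \<notin> \<real>\<^sub>\<ge>\<^sub>0"
  shows "slit_rational (\<lambda>z. eta (ceil_distr \<mu> n) (u z))"
proof -
  obtain V c where V: "finite V" "V \<subseteq> {0..}"
    "\<And>z. resolvent_mean (ceil_distr \<mu> n) z = (\<Sum>v\<in>V. c v / (1 - z * complex_of_real v))"
    using resolvent_mean_ceil_distr_finite[of n] by metis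
  have nz: "resolvent_mean (ceil_distr \<mu> n) (u z) \<noteq> 0" if "z \<notin> \<real>\<^sub>\<ge>\<^sub>0" for z
    by (intro Rplus_prob.resolvent_mean_nonzero ceil_distr_Rplus assms(2) that)
  have "slit_rational (\<lambda>z. \<Sum>v\<in>V. c v / (1 - u z * complex_of_real v))"
    using V(2) assms(2)
    by (intro slit_rational_sum slit_rational_divide slit_rational_diff slit_rational_mult
        slit_rational_const assms(1) resolvent_nonzero) auto
  then have "slit_rational (\<lambda>z. 1 - 1 / (\<Sum>v\<in>V. c v / (1 - u z * complex_of_real v)))"
    using nz V(3) by (intro slit_rational_divide slit_rational_diff slit_rational_const) auto
  then show ?thesis
  proof (rule slit_rational_cong)
    fix z :: complex assume z: "z \<notin> \<real>\<^sub>\<ge>\<^sub>0"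
    show "1 - 1 / (\<Sum>v\<in>V. c v / (1 - u z * complex_of_real v)) = eta (ceil_distr \<mu> n) (u z)"
      using Rplus_prob.eta_eq[OF ceil_distr_Rplus assms(2)[OF z]] V(3) by simp
  qed
qed

end

section \<open>From discretised pairs to the general case\<close>

context Rplus_prob_pair
begin

lemma ceil_pair: "Rplus_prob_pair (ceil_distr M1 n) (ceil_distr M2 n)"
  by (intro Rplus_prob_pair.intro Rplus_prob_pair_axioms.intro M1.ceil_distr_Rplus M2.ceil_distr_Rplus
      M2.ceil_distr_nontrivial nontrivial)

lemma orth_mean_tendsto:
  assumes z: "z \<notin> \<real>\<^sub>\<ge>\<^sub>0"
  shows "(\<lambda>n. orth_mean (ceil_distr M1 n) (ceil_distr M2 n) z) \<longlonglongrightarrow> orth_mean M1 M2 z"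
proof -
  have s: "eta (ceil_distr M2 n) z \<notin> \<real>\<^sub>\<ge>\<^sub>0" for n
    by (intro Rplus_prob.eta_slit M2.ceil_distr_Rplus M2.ceil_distr_nontrivial nontrivial z)
  have s': "eta M2 z \<notin> \<real>\<^sub>\<ge>\<^sub>0" by (intro M2.eta_slit nontrivial z)
  have "(\<lambda>n. eta (ceil_distr M2 n) z) \<longlonglongrightarrow> eta M2 z"
    by (intro M2.eta_ceil_distr_tendsto tendsto_const z)
  moreover from M1.eta_ceil_distr_tendsto[OF s' this s]
  have "(\<lambda>n. eta (ceil_distr M1 n) (eta (ceil_distr M2 n) z)) \<longlonglongrightarrow> eta M1 (eta M2 z)" .
  ultimately have "(\<lambda>n. orth_eta (ceil_distr M1 n) (ceil_distr M2 n) z) \<longlonglongrightarrow> orth_eta M1 M2 z"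
    unfolding orth_eta_def using slit_nonzero[OF s'] by (intro tendsto_intros)
  then show ?thesis
    unfolding orth_mean_def using one_minus_orth_eta[OF z] by (intro tendsto_intros)
qed

lemma slit_rational_orth_mean_ceil: "slit_rational (orth_mean (ceil_distr M1 n) (ceil_distr M2 n))"
proof -
  interpret C: Rplus_prob_pair "ceil_distr M1 n" "ceil_distr M2 n" by (rule ceil_pair)
  have s: "eta (ceil_distr M2 n) z \<notin> \<real>\<^sub>\<ge>\<^sub>0" if "z \<notin> \<real>\<^sub>\<ge>\<^sub>0" for z
    by (intro C.M2.eta_slit C.nontrivial that)
  have 2: "slit_rational (eta (ceil_distr M2 n))"
    using M2.slit_rational_eta_ceil_distr[OF slit_rational_id, of n] by simp
  have "slit_rational (orth_eta (ceil_distr M1 n) (ceil_distr M2 n))"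
    unfolding orth_eta_def[abs_def]
    by (intro slit_rational_divide slit_rational_mult slit_rational_id M1.slit_rational_eta_ceil_distr 2 s slit_nonzero)
  then show ?thesis
    unfolding orth_mean_def[abs_def] using C.one_minus_orth_eta
    by (intro slit_rational_divide slit_rational_diff slit_rational_const) auto
qed

theorem orth_mean_representation:
  "\<exists>\<mu>. prob_measure_Rplus \<mu> \<and> (\<forall>z. z \<notin> \<real>\<^sub>\<ge>\<^sub>0 \<longrightarrow> resolvent_mean \<mu> z = orth_mean M1 M2 z)"
proof (rule resolvent_mean_limit[OF slit_rational_stieltjes])
  fix n
  interpret C: Rplus_prob_pair "ceil_distr M1 n" "ceil_distr M2 n" by (rule ceil_pair)
  show "slit_rational (orth_mean (ceil_distr M1 n) (ceil_distr M2 n))"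
    by (rule slit_rational_orth_mean_ceil)
  show "Im z > 0 \<Longrightarrow> Im (orth_mean (ceil_distr M1 n) (ceil_distr M2 n) z) \<ge> 0"
    "Im z > 0 \<Longrightarrow> Im (z * orth_mean (ceil_distr M1 n) (ceil_distr M2 n) z) \<ge> 0" for z
    by (simp_all only: C.orth_mean_upper)
  show "(\<lambda>k. orth_mean (ceil_distr M1 n) (ceil_distr M2 n) (- inv_Suc k)) \<longlonglongrightarrow> 1"
    by (rule C.orth_mean_tendsto_1)
qed (use orth_mean_tendsto orth_mean_tendsto_1 in auto)

end

text \<open>Translates the exclusion of the point mass at 0 into the almost-everywhere form assumed
  by \<open>Rplus_prob_pair\<close>.\<close>

lemma AE_zero_imp_return:
  assumes "prob_measure_Rplus \<mu>" "AE t in \<mu>. t = 0"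
  shows "\<mu> = return borel_Rplus 0"
proof -
  interpret Rplus_prob \<mu> using assms(1) by (rule prob_measure_RplusD)
  show ?thesis
  proof (rule measure_eqI)
    show "sets \<mu> = sets (return borel_Rplus 0)" by (simp add: sets_Rplus)
    fix A assume A: "A \<in> sets \<mu>"
    have "emeasure \<mu> A = emeasure \<mu> (if 0 \<in> A then space \<mu> else {})"
      using A assms(2) sets.top[of \<mu>] by (intro emeasure_eq_AE) (auto elim!: eventually_mono simp: space_Rplus)
    then show "emeasure \<mu> A = emeasure (return borel_Rplus 0) A"
      using A by (simp add: emeasure_return sets_Rplus emeasure_space_1)
  qed
qed

theorem proposition5p1:
  fixes \<mu>\<^sub>1 \<mu>\<^sub>2 :: "real measure"
  assumes "prob_measure_Rplus \<mu>\<^sub>1"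
    and "prob_measure_Rplus \<mu>\<^sub>2"
    and "\<mu>\<^sub>2 \<noteq> return borel_Rplus 0"
  shows "\<exists>!\<mu>. prob_measure_Rplus \<mu> \<and>
           (\<forall>z. z \<notin> \<real>\<^sub>\<ge>\<^sub>0 \<longrightarrow> eta \<mu> z = z * eta \<mu>\<^sub>1 (eta \<mu>\<^sub>2 z) / eta \<mu>\<^sub>2 z)"
proof -
  interpret Rplus_prob_pair \<mu>\<^sub>1 \<mu>\<^sub>2
    using assms AE_zero_imp_return[of \<mu>\<^sub>2]
    by (auto intro!: Rplus_prob_pair.intro Rplus_prob_pair_axioms.intro prob_measure_RplusD)
  \<comment> \<open>Since eta = 1 - 1/A, the functional equation for eta is an equation between
    resolvent means, to which the representation and uniqueness theorems apply.\<close>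
  have iff: "(\<forall>z. z \<notin> \<real>\<^sub>\<ge>\<^sub>0 \<longrightarrow> eta \<mu> z = z * eta \<mu>\<^sub>1 (eta \<mu>\<^sub>2 z) / eta \<mu>\<^sub>2 z) \<longleftrightarrow>
      (\<forall>z. z \<notin> \<real>\<^sub>\<ge>\<^sub>0 \<longrightarrow> resolvent_mean \<mu> z = orth_mean \<mu>\<^sub>1 \<mu>\<^sub>2 z)" if "Rplus_prob \<mu>" for \<mu>
  proof -
    interpret M: Rplus_prob \<mu> by fact
    have "eta \<mu> z = orth_eta \<mu>\<^sub>1 \<mu>\<^sub>2 z \<longleftrightarrow> resolvent_mean \<mu> z = orth_mean \<mu>\<^sub>1 \<mu>\<^sub>2 z" if "z \<notin> \<real>\<^sub>\<ge>\<^sub>0" for z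
      using M.one_minus_eta[OF that] one_minus_orth_eta[OF that]
      by (metis M.eta_eq[OF that] orth_mean_def diff_diff_eq2 add_diff_cancel_left' div_by_1 divide_divide_eq_right mult_1)
    then show ?thesis unfolding orth_eta_def by blast
  qed
  obtain \<mu> where \<mu>: "prob_measure_Rplus \<mu>"
    "\<forall>z. z \<notin> \<real>\<^sub>\<ge>\<^sub>0 \<longrightarrow> resolvent_mean \<mu> z = orth_mean \<mu>\<^sub>1 \<mu>\<^sub>2 z"
    using orth_mean_representation by blast
  show ?thesis
  proof (rule ex1I[of _ \<mu>])
    show "prob_measure_Rplus \<mu> \<and> (\<forall>z. z \<notin> \<real>\<^sub>\<ge>\<^sub>0 \<longrightarrow> eta \<mu> z = z * eta \<mu>\<^sub>1 (eta \<mu>\<^sub>2 z) / eta \<mu>\<^sub>2 z)"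
      using \<mu> iff[OF prob_measure_RplusD] by blast
    fix \<nu>
    assume \<nu>: "prob_measure_Rplus \<nu> \<and> (\<forall>z. z \<notin> \<real>\<^sub>\<ge>\<^sub>0 \<longrightarrow> eta \<nu> z = z * eta \<mu>\<^sub>1 (eta \<mu>\<^sub>2 z) / eta \<mu>\<^sub>2 z)"
    then have "\<forall>z. z \<notin> \<real>\<^sub>\<ge>\<^sub>0 \<longrightarrow> resolvent_mean \<nu> z = orth_mean \<mu>\<^sub>1 \<mu>\<^sub>2 z"
      using iff[OF prob_measure_RplusD] by blast
    then show "\<nu> = \<mu>"
      using \<mu> \<nu> by (intro resolvent_mean_unique prob_measure_RplusD) (auto simp: slit_iff)
  qed
qed

end
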